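(* Let $H$ be a complex, separable, infinite dimensional Hilbert space, let $T\in L(H)$, and let $\Omega$ be an open, connected subset of $\rho_\ell(T)\cap\sigma(T)$. Let $L:\Omega\to L(H)$ be an operator-valued function. Then $L(\lambda)$ is a left resolvent of $T$ in $\Omega$ if and only if there exists an extension $\tilde{T}$ of $T$ on a larger Hilbert space $\tilde{H}=H\oplus H'$ such that $R(\tilde{T})(\lambda)=(\lambda I-\tilde{T})^{-1}$ exists in $L(\tilde{H})$ for all $\lambda\in\Omega$ and the matrix of $R(\tilde{T})(\lambda)$ with respect to the decomposition $\tilde{H}=H\oplus H'$ has the form $$\begin{pmatrix} L(\lambda) & 0\\ T(\lambda) & V(\lambda)\end{pmatrix},\qquad \lambda\in\Omega,$$ with suitable operator-valued functions $T(\lambda):H\to H'$ and $V(\lambda):H'\to H'$.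
   Context: $L(H)$ is the algebra of all continuous linear operators on a Hilbert space $H$ and $I$ is the identity operator. $\sigma(T)$ is the spectrum of $T$. The left resolvent set $\rho_\ell(T)$ is the set of all $\lambda\in\mathbb{C}$ such that $\lambda I-T$ is left invertible in $L(H)$. For $U\subseteq\rho_\ell(T)$, a map $L:U\to L(H)$ is called a left resolvent of $T$ on $U$ if $L(\lambda)(\lambda I-T)=I$ for all $\lambda\in U$ and $L(\lambda)-L(\mu)=(\mu-\lambda)L(\lambda)L(\mu)$ for all $\lambda,\mu$ in the same connected component of $U$. An extension of $T$ on $\tilde{H}=H\oplus H'$ (orthogonal direct sum of Hilbert spaces, $H$ identified with $H\oplus\{0\}$) is an operator $\tilde{T}\in L(\tilde{H})$ with $\tilde{T}h=Th$ for all $h\in H$. *)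

theory Defs
  imports "HOL-Analysis.Analysis"
begin

section \<open>Complex Hilbert spaces\<close>

class scaleC =
  fixes scaleC :: "complex \<Rightarrow> 'a \<Rightarrow> 'a"  (infixr \<open>*\<^sub>C\<close> 75)

class complex_vector = real_vector + scaleC +
  assumes scaleC_add_right: "a *\<^sub>C (x + y) = a *\<^sub>C x + a *\<^sub>C y"
    and scaleC_add_left: "(a + b) *\<^sub>C x = a *\<^sub>C x + b *\<^sub>C x"
    and scaleC_scaleC: "a *\<^sub>C b *\<^sub>C x = (a * b) *\<^sub>C x"
    and scaleC_one: "1 *\<^sub>C x = x"
    and scaleR_scaleC: "r *\<^sub>R x = complex_of_real r *\<^sub>C x"

global_interpretation complex_vector:
  vector_space "scaleC :: complex \<Rightarrow> 'a \<Rightarrow> 'a::complex_vector"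
  defines csubspace = complex_vector.subspace
    and cspan = complex_vector.span
  by unfold_locales
    (simp_all add: scaleC_add_right scaleC_add_left scaleC_scaleC scaleC_one)

text \<open>The form is linear in its first argument. Building on \<^class>\<open>real_inner\<close> makes the library's
  norm and topology those of the complex inner product: by \<open>inner_Re_cinner\<close> the norm is
  \<open>sqrt (Re (cinner x x))\<close>, and positive definiteness of \<open>cinner\<close> is that of \<open>inner\<close>
  (\<open>cinner x x\<close> being real by \<open>cinner_commute\<close>).\<close>

class complex_inner = complex_vector + real_inner +
  fixes cinner :: "'a \<Rightarrow> 'a \<Rightarrow> complex"
  assumes cinner_commute: "cinner x y = cnj (cinner y x)"
    and cinner_add_left: "cinner (x + y) z = cinner x z + cinner y z"
    and cinner_scaleC_left: "cinner (a *\<^sub>C x) y = a * cinner x y"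
    and inner_Re_cinner: "inner x y = Re (cinner x y)"

class chilbert_space = complex_inner + complete_space

text \<open>The product type carries the orthogonal direct sum structure.\<close>

instantiation prod :: (complex_vector, complex_vector) complex_vector
begin

definition scaleC_prod_def: "a *\<^sub>C p = (a *\<^sub>C fst p, a *\<^sub>C snd p)"

instance
  by standard
    (auto simp: scaleC_prod_def scaleC_add_right scaleC_add_left scaleC_scaleC scaleC_one
      scaleR_scaleC prod_eq_iff)

end

instantiation prod :: (complex_inner, complex_inner) complex_inner
begin

definition cinner_prod_def: "cinner p q = cinner (fst p) (fst q) + cinner (snd p) (snd q)"

instance
proof
  fix p q :: "'a \<times> 'b"
  show "cinner p q = cnj (cinner q p)"
    using cinner_commute[of "fst p" "fst q"] cinner_commute[of "snd p" "snd q"]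
    by (simp add: cinner_prod_def)
qed (simp_all add: cinner_prod_def scaleC_prod_def cinner_add_left cinner_scaleC_left
      inner_prod_def inner_Re_cinner algebra_simps)

end

instance prod :: (chilbert_space, chilbert_space) chilbert_space ..

definition infinite_cdim :: "'a::complex_vector set \<Rightarrow> bool" where
  "infinite_cdim S \<longleftrightarrow> \<not> (\<exists>B. finite B \<and> S \<subseteq> cspan B)"


section \<open>Operators\<close>

text \<open>Since a bound variable cannot range over types, a Hilbert space over which a formula has to
  quantify is a closed complex subspace of a \<^class>\<open>chilbert_space\<close> type, and all operator notions
  are relative to such a set \<open>S\<close> (\<^term>\<open>UNIV\<close> for the whole type). Operators are total functions
  whose values off \<open>S\<close> are irrelevant, so equalities of operators are stated pointwise on \<open>S\<close>.\<close>

definition chilbert_subspace :: "'a::chilbert_space set \<Rightarrow> bool" where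
  "chilbert_subspace S \<longleftrightarrow> csubspace S \<and> closed S"

definition bounded_ops_between ::
    "'a::complex_inner set \<Rightarrow> 'b::complex_inner set \<Rightarrow> ('a \<Rightarrow> 'b) set" where
  "bounded_ops_between S S' =
     {A. (\<forall>x\<in>S. A x \<in> S') \<and>
         (\<forall>x\<in>S. \<forall>y\<in>S. A (x + y) = A x + A y) \<and>
         (\<forall>c. \<forall>x\<in>S. A (c *\<^sub>C x) = c *\<^sub>C A x) \<and>
         (\<exists>K. \<forall>x\<in>S. norm (A x) \<le> K * norm x)}"

abbreviation bounded_ops :: "'a::complex_inner set \<Rightarrow> ('a \<Rightarrow> 'a) set" where
  "bounded_ops S \<equiv> bounded_ops_between S S"

definition left_invertible_on :: "'a::complex_inner set \<Rightarrow> ('a \<Rightarrow> 'a) \<Rightarrow> bool" where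
  "left_invertible_on S A \<longleftrightarrow> (\<exists>B\<in>bounded_ops S. \<forall>x\<in>S. B (A x) = x)"

definition invertible_on :: "'a::complex_inner set \<Rightarrow> ('a \<Rightarrow> 'a) \<Rightarrow> bool" where
  "invertible_on S A \<longleftrightarrow> (\<exists>B\<in>bounded_ops S. (\<forall>x\<in>S. B (A x) = x) \<and> (\<forall>x\<in>S. A (B x) = x))"

definition shift_op :: "complex \<Rightarrow> ('a::complex_vector \<Rightarrow> 'a) \<Rightarrow> 'a \<Rightarrow> 'a" where
  "shift_op z T = (\<lambda>x. z *\<^sub>C x - T x)"

definition spectrum_on :: "'a::complex_inner set \<Rightarrow> ('a \<Rightarrow> 'a) \<Rightarrow> complex set" where
  "spectrum_on S T = {z. \<not> invertible_on S (shift_op z T)}"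

definition left_resolvent_set :: "'a::complex_inner set \<Rightarrow> ('a \<Rightarrow> 'a) \<Rightarrow> complex set" where
  "left_resolvent_set S T = {z. left_invertible_on S (shift_op z T)}"

text \<open>The set-theoretic inverse; it is the operator \<open>(z I - T)\<^sup>-\<^sup>1\<close> when \<open>z \<notin> spectrum_on S T\<close>.\<close>

definition resolvent_on :: "'a::complex_inner set \<Rightarrow> ('a \<Rightarrow> 'a) \<Rightarrow> complex \<Rightarrow> 'a \<Rightarrow> 'a" where
  "resolvent_on S T z = inv_into S (shift_op z T)"

definition left_resolvent_on ::
    "'a::complex_inner set \<Rightarrow> ('a \<Rightarrow> 'a) \<Rightarrow> complex set \<Rightarrow> (complex \<Rightarrow> 'a \<Rightarrow> 'a) \<Rightarrow> bool" where
  "left_resolvent_on S T U L \<longleftrightarrow>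
     U \<subseteq> left_resolvent_set S T \<and>
     (\<forall>z\<in>U. L z \<in> bounded_ops S) \<and>
     (\<forall>z\<in>U. \<forall>x\<in>S. L z (shift_op z T x) = x) \<and>
     (\<forall>C\<in>components U. \<forall>z\<in>C. \<forall>w\<in>C. \<forall>x\<in>S. L z x - L w x = (w - z) *\<^sub>C L z (L w x))"

definition extension_on ::
    "'a::complex_inner set \<Rightarrow> 'b::complex_inner set \<Rightarrow> ('a \<Rightarrow> 'a) \<Rightarrow> ('a \<times> 'b \<Rightarrow> 'a \<times> 'b) \<Rightarrow> bool" where
  "extension_on H H' T T' \<longleftrightarrow>
     T' \<in> bounded_ops (H \<times> H') \<and> (\<forall>h\<in>H. T' (h, 0) = (T h, 0))"

end

theory Submission
  imports Defs
begin

text \<open>An extension of \<open>T\<close> is an upper triangular operator matrix, while its resolvent is required to be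
  lower triangular. If such an extension exists, the first row of the resolvent identity of the extension
  contains only \<open>L\<close> and is the left resolvent identity (\<open>left_resolvent_of_extension\<close>).

  For the converse let \<open>L\<close> be a left resolvent. The identity
  \<open>L w = (I + (z - w) L w) L z\<close> shows that \<open>ker L z\<close> is one and the same closed subspace \<open>N\<close> for
  all \<open>z\<close> in the connected set \<open>\<Omega>\<close>, and \<open>P z = I - (z I - T) L z\<close> is a projection onto \<open>N\<close> along the range
  of \<open>z I - T\<close>. So \<open>N\<close> is exactly what \<open>z I - T\<close> misses, and an extension has to fill this gap. Consider
  an extension of \<open>T\<close> with \<open>- B\<close> as upper right and \<open>C\<close> as lower right entry. It does what is needed
  when \<open>B\<close> maps \<open>H'\<close> into \<open>N\<close>, and, for each \<open>z \<in> \<Omega>\<close>,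
  \<^item> \<open>B\<close> maps \<open>ker (z I - C)\<close> bijectively onto \<open>N\<close>, with a bounded inverse \<open>J z\<close>;
  \<^item> \<open>z I - C\<close> has a bounded right inverse \<open>V z\<close> with \<open>B (V z) = 0\<close>.
  Indeed the lower triangular matrix with entries \<open>L z\<close>, \<open>J z (P z)\<close>, \<open>V z\<close> is then a right inverse of
  \<open>z I - T'\<close>, because \<open>(z I - T) L z + B (J z) (P z) = (I - P z) + P z = I\<close>. Moreover \<open>z I - T'\<close> is
  injective: if it annihilates \<open>(h, k)\<close>, applying \<open>L z\<close> to the first entry \<open>(z I - T) h + B k = 0\<close>
  gives \<open>h = 0\<close>, since \<open>L z\<close> annihilates \<open>N\<close>; then \<open>B k = 0\<close> and \<open>C k = z k\<close> force \<open>k = 0\<close>.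

  The operators \<open>B\<close> and \<open>C\<close> depend on \<open>T\<close> only through \<open>N\<close> and the size of \<open>\<Omega>\<close>. As a part of the spectrum, \<open>\<Omega>\<close>
  lies in a disc \<open>\<bar>z\<bar> < r\<close> (\<open>spectrum_bounded\<close>), and \<open>r\<close> times the backward shift on \<open>\<ell>\<^sup>2(N)\<close> has both
  properties on the entire disc, with \<open>B\<close> the zeroth entry (\<open>weighted_backward_shift\<close>). Separability of
  \<open>H\<close> makes \<open>\<ell>\<^sup>2(N)\<close> separable, so that it embeds into every infinite-dimensional Hilbert space.
  The embedding, the shifts and the zeroth entry are all given by matching orthonormal families
  (\<open>transport\<close>).\<close>

section \<open>Inner products and bounded operators\<close>

lemma cinner_add_right: "cinner x (y + z) = cinner x y + cinner x z"
  by (subst (1 2 3) cinner_commute) (simp add: cinner_add_left)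

lemma cinner_scaleC_right: "cinner x (a *\<^sub>C y) = cnj a * cinner x y"
  by (subst (1 2) cinner_commute) (simp add: cinner_scaleC_left)

lemma cinner_zero_left [simp]: "cinner 0 x = 0"
  using cinner_add_left[of 0 0 x] by simp

lemma cinner_zero_right [simp]: "cinner x 0 = 0"
  using cinner_add_right[of x 0 0] by simp

lemma cinner_diff_left: "cinner (x - y) z = cinner x z - cinner y z"
  using cinner_add_left[of "x - y" y z] by simp

lemma cinner_sum_left: "cinner (\<Sum>k\<in>F. f k) y = (\<Sum>k\<in>F. cinner (f k) y)"
  by (induction F rule: infinite_finite_induct) (simp_all add: cinner_add_left)

lemma cinner_eq_zero_commute: "cinner x y = 0 \<longleftrightarrow> cinner y x = 0"
  by (subst cinner_commute) simp

lemma cinner_same: "cinner x x = complex_of_real ((norm x)\<^sup>2)"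
proof (rule complex_eqI)
  have "cinner x x = cnj (cinner x x)" by (rule cinner_commute)
  then show "Im (cinner x x) = Im (complex_of_real ((norm x)\<^sup>2))"
    by (simp add: complex_eq_iff)
qed (simp add: inner_Re_cinner [symmetric] power2_norm_eq_inner)

lemma norm_scaleC: "norm (a *\<^sub>C x) = cmod a * norm (x :: 'a::complex_inner)"
proof -
  have "complex_of_real ((norm (a *\<^sub>C x))\<^sup>2) = (a * cnj a) * complex_of_real ((norm x)\<^sup>2)"
    using cinner_same[of "a *\<^sub>C x"] cinner_same[of x]
    by (simp add: cinner_scaleC_left cinner_scaleC_right mult_ac)
  also have "\<dots> = complex_of_real ((cmod a * norm x)\<^sup>2)"
    by (simp only: power_mult_distrib of_real_mult complex_norm_square[of a])
  finally have "(norm (a *\<^sub>C x))\<^sup>2 = (cmod a * norm x)\<^sup>2"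
    using of_real_eq_iff by blast
  then show ?thesis by simp
qed

text \<open>Rotating \<open>x\<close> by a phase makes the complex inner product real, which reduces the inequality to
  the one for the underlying real inner product.\<close>

lemma complex_Cauchy_Schwarz: "cmod (cinner x y) \<le> norm x * norm (y :: 'a::complex_inner)"
proof (cases "cinner x y = 0")
  case False
  define a where "a = cnj (cinner x y) / complex_of_real (cmod (cinner x y))"
  have "cinner (a *\<^sub>C x) y = complex_of_real (cmod (cinner x y))"
    using False complex_norm_square[of "cinner x y"]
    by (simp add: a_def cinner_scaleC_left field_simps power2_eq_square)
  then have "cmod (cinner x y) = inner (a *\<^sub>C x) y"
    by (simp add: inner_Re_cinner)
  also have "\<dots> \<le> norm (a *\<^sub>C x) * norm y"
    by (rule norm_cauchy_schwarz)
  also have "\<dots> = norm x * norm y"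
    using False by (simp add: norm_scaleC a_def norm_divide)
  finally show ?thesis .
qed simp

lemma bounded_linear_cinner_left: "bounded_linear (\<lambda>x :: 'a::complex_inner. cinner x y)"
  by (rule bounded_linear_intro[where K = "norm y"])
    (simp_all add: cinner_add_left scaleR_scaleC cinner_scaleC_left complex_Cauchy_Schwarz
      flip: scaleR_conv_of_real)

lemma bounded_ops_mem: "A \<in> bounded_ops_between S S' \<Longrightarrow> x \<in> S \<Longrightarrow> A x \<in> S'"
  and bounded_ops_add: "A \<in> bounded_ops_between S S' \<Longrightarrow> x \<in> S \<Longrightarrow> y \<in> S \<Longrightarrow> A (x + y) = A x + A y"
  and bounded_ops_scaleC: "A \<in> bounded_ops_between S S' \<Longrightarrow> x \<in> S \<Longrightarrow> A (c *\<^sub>C x) = c *\<^sub>C A x"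
  by (simp_all add: bounded_ops_between_def)

lemma bounded_ops_bound:
  assumes "A \<in> bounded_ops_between S S'"
  obtains K where "K \<ge> 0" "\<And>x. x \<in> S \<Longrightarrow> norm (A x) \<le> K * norm x"
proof -
  obtain K where K: "\<And>x. x \<in> S \<Longrightarrow> norm (A x) \<le> K * norm x"
    using assms unfolding bounded_ops_between_def by blast
  have "norm (A x) \<le> max 0 K * norm x" if "x \<in> S" for x
    using K[OF that] by (meson max.cobounded2 mult_right_mono norm_ge_zero order_trans)
  then show thesis using that[of "max 0 K"] by simp
qed

lemma bounded_ops_betweenI:
  assumes "\<And>x. x \<in> S \<Longrightarrow> A x \<in> S'"
    and "\<And>x y. x \<in> S \<Longrightarrow> y \<in> S \<Longrightarrow> A (x + y) = A x + A y"
    and "\<And>c x. x \<in> S \<Longrightarrow> A (c *\<^sub>C x) = c *\<^sub>C A x"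
    and "\<And>x. x \<in> S \<Longrightarrow> norm (A x) \<le> K * norm x"
  shows "A \<in> bounded_ops_between S S'"
  using assms unfolding bounded_ops_between_def by blast

lemma bounded_ops_diff:
  assumes A: "A \<in> bounded_ops_between S S'" and S: "csubspace S" and "x \<in> S" "y \<in> S"
  shows "A (x - y) = A x - A y"
proof -
  have "x - y \<in> S" using assms complex_vector.subspace_diff by blast
  then have "A (x - y + y) = A (x - y) + A y"
    using assms bounded_ops_add by blast
  then show ?thesis by simp
qed

lemma bounded_ops_subset:
  "A \<in> bounded_ops_between S S' \<Longrightarrow> R \<subseteq> S \<Longrightarrow> (\<And>x. x \<in> R \<Longrightarrow> A x \<in> R') \<Longrightarrow> A \<in> bounded_ops_between R R'"
  unfolding bounded_ops_between_def by blast

lemma bounded_ops_ident: "(\<lambda>x. x) \<in> bounded_ops S"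
  by (rule bounded_ops_betweenI[where K = 1]) simp_all

lemma bounded_ops_compose:
  assumes A: "A \<in> bounded_ops_between S S'" and D: "D \<in> bounded_ops_between S' S''"
  shows "(\<lambda>x. D (A x)) \<in> bounded_ops_between S S''"
proof -
  obtain K where K: "\<And>x. x \<in> S \<Longrightarrow> norm (A x) \<le> K * norm x"
    using bounded_ops_bound[OF A] by blast
  obtain K' where K': "K' \<ge> 0" "\<And>x. x \<in> S' \<Longrightarrow> norm (D x) \<le> K' * norm x"
    using bounded_ops_bound[OF D] by blast
  show ?thesis
  proof (rule bounded_ops_betweenI[where K = "K' * K"])
    fix x assume x: "x \<in> S"
    have "norm (D (A x)) \<le> K' * norm (A x)"
      using K'(2) bounded_ops_mem[OF A x] by blast
    also have "\<dots> \<le> K' * (K * norm x)"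
      using K[OF x] K'(1) by (rule mult_left_mono)
    finally show "norm (D (A x)) \<le> K' * K * norm x" by simp
  qed (use bounded_ops_mem[OF A] bounded_ops_mem[OF D] in
        \<open>simp_all add: bounded_ops_add[OF A] bounded_ops_add[OF D]
          bounded_ops_scaleC[OF A] bounded_ops_scaleC[OF D]\<close>)
qed

lemma bounded_ops_cmult:
  assumes A: "A \<in> bounded_ops_between S S'" and S': "csubspace S'"
  shows "(\<lambda>x. c *\<^sub>C A x) \<in> bounded_ops_between S S'"
proof -
  have "(\<lambda>x. c *\<^sub>C x) \<in> bounded_ops S'"
    by (rule bounded_ops_betweenI[where K = "cmod c"])
      (auto simp: norm_scaleC scaleC_add_right scaleC_scaleC mult.commute
        intro: complex_vector.subspace_scale[OF S'])
  from bounded_ops_compose[OF A this] show ?thesis .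
qed

lemma bounded_ops_plus:
  assumes A: "A \<in> bounded_ops_between S S'" and D: "D \<in> bounded_ops_between S S'"
    and S': "csubspace S'"
  shows "(\<lambda>x. A x + D x) \<in> bounded_ops_between S S'"
proof -
  obtain K where K: "\<And>x. x \<in> S \<Longrightarrow> norm (A x) \<le> K * norm x"
    using bounded_ops_bound[OF A] by blast
  obtain K' where K': "\<And>x. x \<in> S \<Longrightarrow> norm (D x) \<le> K' * norm x"
    using bounded_ops_bound[OF D] by blast
  show ?thesis
  proof (rule bounded_ops_betweenI[where K = "K + K'"])
    show "norm (A x + D x) \<le> (K + K') * norm x" if "x \<in> S" for x
      using norm_triangle_ineq[of "A x" "D x"] K[OF that] K'[OF that] by (simp add: algebra_simps)
  qed (use bounded_ops_mem[OF A] bounded_ops_mem[OF D] complex_vector.subspace_add[OF S'] in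
      \<open>simp_all add: bounded_ops_add[OF A] bounded_ops_add[OF D]
        bounded_ops_scaleC[OF A] bounded_ops_scaleC[OF D] scaleC_add_right\<close>)
qed

lemma bounded_ops_minus:
  assumes A: "A \<in> bounded_ops_between S S'" and D: "D \<in> bounded_ops_between S S'"
    and S': "csubspace S'"
  shows "(\<lambda>x. A x - D x) \<in> bounded_ops_between S S'"
  using bounded_ops_plus[OF A bounded_ops_cmult[OF D S', of "- 1"] S'] by simp

lemma bounded_ops_fst: "fst \<in> bounded_ops_between (S \<times> S') S"
  unfolding bounded_ops_between_def
  by (auto simp: scaleC_prod_def intro!: exI[of _ 1] norm_fst_le)

lemma bounded_ops_snd: "snd \<in> bounded_ops_between (S \<times> S') S'"
  unfolding bounded_ops_between_def
  by (auto simp: scaleC_prod_def intro!: exI[of _ 1] norm_snd_le)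

lemma bounded_ops_Pair:
  assumes A: "A \<in> bounded_ops_between S R" and D: "D \<in> bounded_ops_between S R'"
  shows "(\<lambda>x. (A x, D x)) \<in> bounded_ops_between S (R \<times> R')"
proof -
  obtain K where K: "\<And>x. x \<in> S \<Longrightarrow> norm (A x) \<le> K * norm x"
    using bounded_ops_bound[OF A] by blast
  obtain K' where K': "\<And>x. x \<in> S \<Longrightarrow> norm (D x) \<le> K' * norm x"
    using bounded_ops_bound[OF D] by blast
  show ?thesis
  proof (rule bounded_ops_betweenI[where K = "K + K'"])
    show "norm (A x, D x) \<le> (K + K') * norm x" if "x \<in> S" for x
      using norm_Pair_le[of "A x" "D x"] K[OF that] K'[OF that] by (simp add: algebra_simps)
  qed (use bounded_ops_mem[OF A] bounded_ops_mem[OF D] in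
      \<open>simp_all add: bounded_ops_add[OF A] bounded_ops_add[OF D]
        bounded_ops_scaleC[OF A] bounded_ops_scaleC[OF D] scaleC_prod_def\<close>)
qed

lemma bounded_ops_imp_bounded_linear:
  assumes "A \<in> bounded_ops_between UNIV S'"
  shows "bounded_linear A"
proof -
  obtain K where K: "\<And>x. x \<in> UNIV \<Longrightarrow> norm (A x) \<le> K * norm x"
    using bounded_ops_bound[OF assms] by blast
  have "A (r *\<^sub>R x) = r *\<^sub>R A x" for r x
    unfolding scaleR_scaleC by (rule bounded_ops_scaleC[OF assms UNIV_I])
  moreover have "norm (A x) \<le> norm x * K" for x
    using K[OF UNIV_I, of x] by (simp only: mult.commute)
  ultimately show ?thesis
    by (intro bounded_linear_intro bounded_ops_add[OF assms UNIV_I UNIV_I])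
qed

lemma chilbert_subspace_kernel:
  assumes A: "A \<in> bounded_ops_between UNIV S'"
  shows "chilbert_subspace {x. A x = 0}"
proof -
  interpret bounded_linear A using A by (rule bounded_ops_imp_bounded_linear)
  have "closed {x. A x = 0}"
    by (rule closed_Collect_eq[OF continuous_on[OF continuous_on_id] continuous_on_const])
  moreover have "csubspace {x. A x = 0}"
    by (rule complex_vector.subspaceI)
      (simp_all add: zero bounded_ops_add[OF A] bounded_ops_scaleC[OF A])
  ultimately show ?thesis
    unfolding chilbert_subspace_def by blast
qed

section \<open>Neumann inversion and boundedness of the spectrum\<close>

text \<open>\<open>x\<close> solves \<open>x - A x = y\<close> iff it is a fixed point of the contraction \<open>x \<mapsto> y + A x\<close>; linearity of
  the solution in \<open>y\<close> follows from its uniqueness.\<close>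

lemma contraction_resolvent:
  assumes S: "chilbert_subspace S" and A: "A \<in> bounded_ops S"
    and q: "0 \<le> q" "q < 1" and Aq: "\<And>x. x \<in> S \<Longrightarrow> norm (A x) \<le> q * norm x"
  obtains G where "G \<in> bounded_ops S"
    "\<And>y. y \<in> S \<Longrightarrow> G y - A (G y) = y" "\<And>x. x \<in> S \<Longrightarrow> G (x - A x) = x"
proof -
  have sub: "csubspace S" and "closed S"
    using S unfolding chilbert_subspace_def by blast+
  have "complete S" using \<open>closed S\<close> by (simp add: complete_eq_closed)
  have "S \<noteq> {}" using complex_vector.subspace_0[OF sub] by auto
  have ex1: "\<exists>!x\<in>S. y + A x = x" if y: "y \<in> S" for y
  proof (rule Banach_fix[OF \<open>complete S\<close> \<open>S \<noteq> {}\<close> q])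
    show "(\<lambda>x. y + A x) ` S \<subseteq> S"
      by (auto intro!: bounded_ops_mem[OF A] y complex_vector.subspace_add[OF sub])
    fix u v assume uv: "u \<in> S" "v \<in> S"
    then have "u - v \<in> S" using complex_vector.subspace_diff[OF sub] by blast
    from Aq[OF this] show "dist (y + A u) (y + A v) \<le> q * dist u v"
      by (simp add: dist_norm bounded_ops_diff[OF A sub uv])
  qed
  define G where "G y = (THE x. x \<in> S \<and> y + A x = x)" for y
  have "G y \<in> S \<and> y + A (G y) = G y" if "y \<in> S" for y
    unfolding G_def by (rule theI'[OF ex1[OF that]])
  then have G: "G y \<in> S" "y + A (G y) = G y" if "y \<in> S" for y
    by (simp_all only: that)
  have uniq: "G y = x" if "y \<in> S" "x \<in> S" "y + A x = x" for x y
    unfolding G_def by (rule the1_equality[OF ex1[OF that(1)]]) (intro conjI that)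
  show thesis
  proof
    show "G \<in> bounded_ops S"
    proof (rule bounded_ops_betweenI[where K = "1 / (1 - q)"])
      fix x y assume xy: "x \<in> S" "y \<in> S"
      have "(x + y) + A (G x + G y) = (x + A (G x)) + (y + A (G y))"
        unfolding bounded_ops_add[OF A G(1)[OF xy(1)] G(1)[OF xy(2)]] by (simp only: add_ac)
      also have "\<dots> = G x + G y" by (simp only: G(2) xy)
      finally show "G (x + y) = G x + G y"
        by (rule uniq[OF complex_vector.subspace_add[OF sub xy]
              complex_vector.subspace_add[OF sub G(1)[OF xy(1)] G(1)[OF xy(2)]]])
    next
      fix c x assume x: "x \<in> S"
      have "c *\<^sub>C x + A (c *\<^sub>C G x) = c *\<^sub>C (x + A (G x))"
        by (simp only: bounded_ops_scaleC[OF A G(1)[OF x]] scaleC_add_right)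
      also have "\<dots> = c *\<^sub>C G x" by (simp only: G(2) x)
      finally show "G (c *\<^sub>C x) = c *\<^sub>C G x"
        by (rule uniq[OF complex_vector.subspace_scale[OF sub x]
              complex_vector.subspace_scale[OF sub G(1)[OF x]]])
    next
      fix x assume x: "x \<in> S"
      have "norm (G x) \<le> norm x + norm (A (G x))"
        using norm_triangle_ineq[of x "A (G x)"] G[OF x] by simp
      also have "\<dots> \<le> norm x + q * norm (G x)"
        using Aq G[OF x] by simp
      finally show "norm (G x) \<le> 1 / (1 - q) * norm x"
        using q by (simp add: field_simps)
    qed (rule G(1))
    show "G y - A (G y) = y" if "y \<in> S" for y
      using G[OF that] by (simp add: algebra_simps)
    show "G (x - A x) = x" if "x \<in> S" for x
      using that bounded_ops_mem[OF A that] complex_vector.subspace_diff[OF sub]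
      by (intro uniq) simp_all
  qed
qed

lemma spectrum_bounded:
  fixes T :: "'a::chilbert_space \<Rightarrow> 'a"
  assumes T: "T \<in> bounded_ops UNIV"
  obtains r where "r > 0" "\<And>z. z \<in> spectrum_on UNIV T \<Longrightarrow> cmod z < r"
proof -
  obtain K where K: "K \<ge> 0" "\<And>x. x \<in> UNIV \<Longrightarrow> norm (T x) \<le> K * norm x"
    using bounded_ops_bound[OF T] by blast
  have "invertible_on UNIV (shift_op z T)" if z: "cmod z \<ge> K + 1" for z
  proof -
    from z K have z0: "z \<noteq> 0" by auto
    define A where "A x = (1 / z) *\<^sub>C T x" for x
    have UNIV: "chilbert_subspace (UNIV :: 'a set)" and sub: "csubspace (UNIV :: 'a set)"
      by (simp_all add: chilbert_subspace_def)
    have A: "A \<in> bounded_ops UNIV"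
      unfolding A_def by (rule bounded_ops_cmult[OF T sub])
    have "norm (A x) \<le> (K / cmod z) * norm x" for x
      using K(2)[OF UNIV_I, of x] by (simp add: A_def norm_scaleC norm_divide divide_right_mono)
    moreover have "0 \<le> K / cmod z" "K / cmod z < 1"
      using K z z0 by auto
    ultimately obtain G where G: "G \<in> bounded_ops UNIV"
      "\<And>y. G y - A (G y) = y" "\<And>x. G (x - A x) = x"
      using contraction_resolvent[OF UNIV A] by (metis UNIV_I)
    have zA: "z *\<^sub>C A x = T x" for x
      using z0 by (simp add: A_def scaleC_scaleC scaleC_one)
    have shift: "shift_op z T x = z *\<^sub>C (x - A x)" for x
      by (simp add: shift_op_def zA complex_vector.scale_right_diff_distrib)
    have "(\<lambda>x. (1 / z) *\<^sub>C G x) \<in> bounded_ops UNIV"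
      by (rule bounded_ops_cmult[OF G(1) sub])
    moreover have "(1 / z) *\<^sub>C G (shift_op z T x) = x" for x
      using z0 by (simp add: shift bounded_ops_scaleC[OF G(1)] G scaleC_scaleC scaleC_one)
    moreover have "shift_op z T ((1 / z) *\<^sub>C G x) = x" for x
    proof -
      have "shift_op z T ((1 / z) *\<^sub>C G x) = z *\<^sub>C ((1 / z) *\<^sub>C (G x - A (G x)))"
        unfolding shift by (simp add: bounded_ops_scaleC[OF A] complex_vector.scale_right_diff_distrib)
      then show ?thesis using z0 by (simp add: G scaleC_scaleC scaleC_one)
    qed
    ultimately show ?thesis unfolding invertible_on_def by (intro bexI conjI ballI)
  qed
  then have "cmod z < K + 1" if "z \<in> spectrum_on UNIV T" for z
    using that unfolding spectrum_on_def by force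
  then show thesis using that[of "K + 1"] K(1) by simp
qed

section \<open>Orthonormal families and the operators that transport coordinates\<close>

text \<open>Zero vectors are admitted, so that a Hilbert space of any countable dimension has a complete
  family indexed by the natural numbers.\<close>

definition orthonormal_or_zero :: "'i set \<Rightarrow> ('i \<Rightarrow> 'a::complex_inner) \<Rightarrow> bool" where
  "orthonormal_or_zero I u \<longleftrightarrow>
     (\<forall>j\<in>I. \<forall>k\<in>I. j \<noteq> k \<longrightarrow> cinner (u j) (u k) = 0) \<and> (\<forall>k\<in>I. norm (u k) = 1 \<or> u k = 0)"

lemma orthonormal_or_zero_orth:
  "orthonormal_or_zero I u \<Longrightarrow> j \<in> I \<Longrightarrow> k \<in> I \<Longrightarrow> j \<noteq> k \<Longrightarrow> cinner (u j) (u k) = 0"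
  by (simp add: orthonormal_or_zero_def)

lemma orthonormal_or_zero_norm:
  "orthonormal_or_zero I u \<Longrightarrow> k \<in> I \<Longrightarrow> norm (u k) = 1 \<or> u k = 0"
  by (simp add: orthonormal_or_zero_def)

lemma cinner_same_scaleC:
  assumes "norm v = 1 \<or> v = 0"
  shows "cinner v v *\<^sub>C v = v"
  using assms by (auto simp: cinner_same scaleC_one)

lemma cinner_mult_cinner_same:
  assumes "norm v = 1 \<or> v = 0"
  shows "cinner x v * cinner v v = cinner x v"
  using assms by (auto simp: cinner_same)

lemma cinner_orthonormal_sum:
  assumes u: "orthonormal_or_zero I u" and F: "finite F" "F \<subseteq> I" and j: "j \<in> F"
  shows "cinner (\<Sum>k\<in>F. c k *\<^sub>C u k) (u j) = c j * cinner (u j) (u j)"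
proof -
  have "cinner (\<Sum>k\<in>F. c k *\<^sub>C u k) (u j) = (\<Sum>k\<in>F. c k * cinner (u k) (u j))"
    by (simp add: cinner_sum_left cinner_scaleC_left)
  also have "\<dots> = (\<Sum>k\<in>F. if k = j then c j * cinner (u j) (u j) else 0)"
    using F j orthonormal_or_zero_orth[OF u] by (intro sum.cong) auto
  also have "\<dots> = c j * cinner (u j) (u j)"
    using F j by simp
  finally show ?thesis .
qed

lemma norm_add_orthogonal:
  assumes "cinner x y = 0"
  shows "(norm (x + y))\<^sup>2 = (norm x)\<^sup>2 + (norm y)\<^sup>2"
  using assms by (intro norm_add_Pythagorean) (simp add: orthogonal_def inner_Re_cinner)

lemma norm_orthonormal_sum:
  assumes u: "orthonormal_or_zero I u" and F: "finite F" "F \<subseteq> I"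
  shows "(norm (\<Sum>k\<in>F. c k *\<^sub>C u k))\<^sup>2 = (\<Sum>k\<in>F. (cmod (c k) * norm (u k))\<^sup>2)"
  using F
proof (induction F rule: finite_induct)
  case (insert j F)
  have "cinner (u k) (u j) = 0" if "k \<in> F" for k
    using insert.prems insert.hyps that by (intro orthonormal_or_zero_orth[OF u]) auto
  then have "cinner (\<Sum>k\<in>F. c k *\<^sub>C u k) (c j *\<^sub>C u j) = 0"
    by (simp add: cinner_sum_left cinner_scaleC_left cinner_scaleC_right)
  then have "cinner (c j *\<^sub>C u j) (\<Sum>k\<in>F. c k *\<^sub>C u k) = 0"
    by (simp only: cinner_eq_zero_commute)
  from norm_add_orthogonal[OF this] show ?case
    using insert by (simp add: norm_scaleC)
qed simp

lemma residual_orthogonal: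
  assumes u: "orthonormal_or_zero I u" and F: "finite F" "F \<subseteq> I" and j: "j \<in> F"
  shows "cinner (x - (\<Sum>k\<in>F. cinner x (u k) *\<^sub>C u k)) (u j) = 0"
proof -
  have "cinner x (u j) * cinner (u j) (u j) = cinner x (u j)"
    using F j by (intro cinner_mult_cinner_same orthonormal_or_zero_norm[OF u]) auto
  then show ?thesis
    by (simp add: cinner_diff_left cinner_orthonormal_sum[OF u F j])
qed

lemma Bessel_inequality:
  assumes u: "orthonormal_or_zero I u" and F: "finite F" "F \<subseteq> I"
  shows "(\<Sum>k\<in>F. (cmod (cinner x (u k)))\<^sup>2) \<le> (norm x)\<^sup>2"
proof -
  define s where "s = (\<Sum>k\<in>F. cinner x (u k) *\<^sub>C u k)"
  have "cinner (u k) (x - s) = 0" if "k \<in> F" for k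
    using residual_orthogonal[OF u F that, of x] unfolding s_def cinner_eq_zero_commute[of "u k"] .
  then have "cinner s (x - s) = 0"
    unfolding s_def by (simp add: cinner_sum_left cinner_scaleC_left)
  from norm_add_orthogonal[OF this] have "(norm s)\<^sup>2 \<le> (norm x)\<^sup>2"
    by simp
  moreover have "(norm s)\<^sup>2 = (\<Sum>k\<in>F. (cmod (cinner x (u k)))\<^sup>2)"
    unfolding s_def norm_orthonormal_sum[OF u F]
  proof (rule sum.cong)
    show "(cmod (cinner x (u k)) * norm (u k))\<^sup>2 = (cmod (cinner x (u k)))\<^sup>2" if "k \<in> F" for k
      using orthonormal_or_zero_norm[OF u, of k] F that by auto
  qed simp
  ultimately show ?thesis by simp
qed

text \<open>By Pythagoras the partial sums of an orthogonal series form a Cauchy net as soon as the squares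
  of the coefficients are summable.\<close>

lemma orthonormal_series:
  fixes v :: "'i \<Rightarrow> 'a::chilbert_space"
  assumes v: "orthonormal_or_zero UNIV v" and "M \<ge> 0"
    and bound: "\<And>F. finite F \<Longrightarrow> (\<Sum>k\<in>F. (cmod (c k))\<^sup>2) \<le> M\<^sup>2"
  shows "(\<lambda>k. c k *\<^sub>C v k) summable_on UNIV" "norm (\<Sum>\<^sub>\<infinity>k. c k *\<^sub>C v k) \<le> M"
proof -
  let ?s = "\<lambda>F. \<Sum>k\<in>F. c k *\<^sub>C v k"
  let ?q = "\<lambda>k. (cmod (c k))\<^sup>2"
  have sq: "(norm (?s F))\<^sup>2 \<le> sum ?q F" if "finite F" for F
    unfolding norm_orthonormal_sum[OF v that subset_UNIV]
  proof (rule sum_mono)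
    show "(cmod (c k) * norm (v k))\<^sup>2 \<le> (cmod (c k))\<^sup>2" for k
      using orthonormal_or_zero_norm[OF v UNIV_I, of k] by auto
  qed
  have "?q summable_on UNIV"
    by (rule nonneg_bdd_above_summable_on) (auto simp: bdd_above_def intro!: exI[of _ "M\<^sup>2"] bound)
  then have q: "(?q has_sum infsum ?q UNIV) UNIV" by simp
  have "cauchy_filter (filtermap ?s (finite_subsets_at_top UNIV))"
    unfolding cauchy_filter_metric_filtermap
  proof (intro allI impI)
    fix e :: real assume e: "e > 0"
    then have "(e / 2)\<^sup>2 / 2 > 0" by simp
    then obtain F0 where F0: "finite F0" "dist (sum ?q F0) (infsum ?q UNIV) \<le> (e / 2)\<^sup>2 / 2"
      using has_sum_finite_approximation[OF q] by blast
    have near: "dist (?s F) (?s F0) < e / 2" if F: "finite F" "F0 \<subseteq> F" for F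
    proof -
      have "sum ?q F \<le> infsum ?q UNIV"
        by (rule finite_sum_le_has_sum[OF q F(1) subset_UNIV]) simp
      moreover have "infsum ?q UNIV - sum ?q F0 \<le> (e / 2)\<^sup>2 / 2"
        using F0(2) unfolding dist_real_def by linarith
      moreover have "sum ?q (F - F0) = sum ?q F - sum ?q F0"
        by (rule sum_diff[OF F])
      ultimately have "sum ?q (F - F0) \<le> (e / 2)\<^sup>2 / 2"
        by linarith
      also have "\<dots> < (e / 2)\<^sup>2" using e by simp
      finally have "(norm (?s (F - F0)))\<^sup>2 < (e / 2)\<^sup>2"
        using sq[of "F - F0"] F by simp
      then have "norm (?s (F - F0)) < e / 2"
        by (rule power_less_imp_less_base) (use e in simp)
      then show ?thesis
        using F F0 by (simp add: dist_norm sum_diff)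
    qed
    have "eventually (\<lambda>F. finite F \<and> F0 \<subseteq> F) (finite_subsets_at_top UNIV)"
      using F0(1) by (auto simp: eventually_finite_subsets_at_top)
    moreover have "dist (?s F) (?s F') < e"
      if "finite F \<and> F0 \<subseteq> F" "finite F' \<and> F0 \<subseteq> F'" for F F'
      by (rule dist_triangle_half_l[OF near near])
        (simp_all only: conjunct1[OF that(1)] conjunct2[OF that(1)]
          conjunct1[OF that(2)] conjunct2[OF that(2)])
    ultimately show "\<exists>P. eventually P (finite_subsets_at_top UNIV) \<and>
        (\<forall>F F'. P F \<and> P F' \<longrightarrow> dist (?s F) (?s F') < e)"
      by (intro exI[of _ "\<lambda>F. finite F \<and> F0 \<subseteq> F"] conjI allI impI) blast+
  qed
  moreover have "complete (UNIV :: 'a set)"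
    by (rule complete_UNIV)
  ultimately obtain y where "(?s \<longlongrightarrow> y) (finite_subsets_at_top UNIV)"
    using complete_uniform[where S = "UNIV :: 'a set"] by (force simp: filterlim_def)
  then show summable: "(\<lambda>k. c k *\<^sub>C v k) summable_on UNIV"
    unfolding summable_on_def has_sum_def by (rule exI)
  have "norm (?s F) \<le> M" if "finite F" for F
    using order_trans[OF sq[OF that] bound[OF that]] \<open>M \<ge> 0\<close> by (rule power2_le_imp_le)
  then show "norm (\<Sum>\<^sub>\<infinity>k. c k *\<^sub>C v k) \<le> M"
    using infsum_tendsto[OF summable]
    by (intro tendsto_upperbound[OF tendsto_norm] eventually_finite_subsets_at_top_weakI) auto
qed

text \<open>For orthonormal families this is the partial isometry that turns the \<open>u\<close>-coordinates of \<open>x\<close> into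
  \<open>v\<close>-coordinates. Shifts, embeddings and orthogonal projections are all of this form.\<close>

definition transport :: "('i \<Rightarrow> 'a::complex_inner) \<Rightarrow> ('i \<Rightarrow> 'b::complex_inner) \<Rightarrow> 'a \<Rightarrow> 'b" where
  "transport u v x = (\<Sum>\<^sub>\<infinity>k. cinner x (u k) *\<^sub>C v k)"

context
  fixes u :: "'i \<Rightarrow> 'a::complex_inner" and v :: "'i \<Rightarrow> 'b::chilbert_space"
  assumes u: "orthonormal_or_zero UNIV u" and v: "orthonormal_or_zero UNIV v"
begin

lemma has_sum_transport: "((\<lambda>k. cinner x (u k) *\<^sub>C v k) has_sum transport u v x) UNIV"
  unfolding transport_def
  by (intro has_sum_infsum orthonormal_series(1)[OF v norm_ge_zero[of x]] Bessel_inequality[OF u])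
    simp_all

lemma norm_transport_le: "norm (transport u v x) \<le> norm x"
  unfolding transport_def
  by (rule orthonormal_series(2)[OF v norm_ge_zero Bessel_inequality[OF u]]) simp_all

lemma transport_bounded_ops: "transport u v \<in> bounded_ops_between UNIV UNIV"
proof (rule bounded_ops_betweenI[where K = 1])
  show "transport u v (x + y) = transport u v x + transport u v y" for x y
    by (rule has_sum_unique[OF has_sum_transport])
      (simp add: cinner_add_left scaleC_add_left has_sum_add[OF has_sum_transport has_sum_transport])
next
  fix a x
  have "bounded_linear (\<lambda>y :: 'b. a *\<^sub>C y)"
    by (rule bounded_ops_imp_bounded_linear[OF bounded_ops_cmult[OF bounded_ops_ident]])
      simp
  from has_sum_bounded_linear[OF this has_sum_transport[of x]]
  show "transport u v (a *\<^sub>C x) = a *\<^sub>C transport u v x"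
    by (intro has_sum_unique[OF has_sum_transport]) (simp add: cinner_scaleC_left scaleC_scaleC)
next
  show "norm (transport u v x) \<le> 1 * norm x" for x
    using norm_transport_le by simp
qed simp

lemma has_sum_cinner_transport:
  "((\<lambda>k. cinner x (u k) * cinner (v k) w) has_sum cinner (transport u v x) w) UNIV"
  using has_sum_bounded_linear[OF bounded_linear_cinner_left[of w] has_sum_transport[of x]]
  by (simp add: cinner_scaleC_left)

lemma cinner_transport_orthogonal:
  assumes "\<And>k. cinner (v k) w = 0"
  shows "cinner (transport u v x) w = 0"
  by (rule has_sum_unique[OF has_sum_cinner_transport]) (simp add: assms)

lemma cinner_transport:
  assumes "v k = 0 \<Longrightarrow> u k = 0"
  shows "cinner (transport u v x) (v k) = cinner x (u k)"
proof -
  have "cinner x (u j) * cinner (v j) (v k) = (if j = k then cinner x (u k) else 0)" for j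
    using orthonormal_or_zero_orth[OF v, of j k] orthonormal_or_zero_norm[OF v, of k] assms
    by (auto simp: cinner_same)
  then have "((\<lambda>j. if j = k then cinner x (u k) else 0) has_sum cinner (transport u v x) (v k)) UNIV"
    using has_sum_cinner_transport[of x "v k"] by simp
  moreover have "((\<lambda>j. if j = k then cinner x (u k) else 0) has_sum cinner x (u k)) UNIV"
    by (subst has_sum_cong_neutral[where T = "{k}"]) (auto intro!: has_sum_finiteI)
  ultimately show ?thesis by (rule has_sum_unique)
qed

lemma transport_basis:
  assumes "u k = 0 \<Longrightarrow> v k = 0"
  shows "transport u v (u k) = v k"
proof -
  have "cinner (u k) (u j) *\<^sub>C v j = (if j = k then v k else 0)" for j
    using orthonormal_or_zero_orth[OF u, of k j] orthonormal_or_zero_norm[OF u, of k] assms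
    by (auto simp: cinner_same scaleC_one)
  then have "((\<lambda>j. if j = k then v k else 0) has_sum transport u v (u k)) UNIV"
    using has_sum_transport[of "u k"] by simp
  moreover have "((\<lambda>j. if j = k then v k else 0) has_sum v k) UNIV"
    by (subst has_sum_cong_neutral[where T = "{k}"]) (auto intro!: has_sum_finiteI)
  ultimately show ?thesis by (rule has_sum_unique)
qed

lemma transport_in_subspace:
  assumes S: "chilbert_subspace S" and vS: "\<And>k. v k \<in> S"
  shows "transport u v x \<in> S"
proof -
  have sub: "csubspace S" and "closed S"
    using S unfolding chilbert_subspace_def by blast+
  have "(\<Sum>k\<in>F. cinner x (u k) *\<^sub>C v k) \<in> S" for F
    by (intro complex_vector.subspace_sum[OF sub] complex_vector.subspace_scale[OF sub] vS)
  then show ?thesis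
    using has_sum_transport[of x] unfolding has_sum_def
    by (intro Lim_in_closed_set[OF \<open>closed S\<close>]) auto
qed

end

text \<open>Transports are determined by coordinates, so they compose like the matchings of indices that
  define them.\<close>

lemma transport_transport:
  fixes v :: "'i \<Rightarrow> 'b::chilbert_space"
  assumes "orthonormal_or_zero UNIV u" "orthonormal_or_zero UNIV v" "\<And>k. v k = 0 \<Longrightarrow> u k = 0"
  shows "transport v w (transport u v x) = transport u w x"
  unfolding transport_def[of v w] transport_def[of u w] by (simp add: cinner_transport assms)

lemma transport_eq_0: "(\<And>k. cinner x (u k) = 0) \<Longrightarrow> transport u v x = 0"
  by (simp add: transport_def)

lemma transport_self_fixed_subspace:
  fixes u :: "'i \<Rightarrow> 'a::chilbert_space"
  assumes "orthonormal_or_zero UNIV u"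
  shows "chilbert_subspace {x. transport u u x = x}"
  using chilbert_subspace_kernel[OF bounded_ops_minus[OF
      transport_bounded_ops[OF assms assms] bounded_ops_ident]] by simp

section \<open>Existence of orthonormal families\<close>

lemma orthonormal_or_zero_sequenceI:
  fixes e :: "nat \<Rightarrow> 'a::complex_inner"
  assumes "\<And>m. m < n \<Longrightarrow> norm (e m) = 1 \<or> e m = 0"
    and "\<And>m k. m < k \<Longrightarrow> k < n \<Longrightarrow> cinner (e k) (e m) = 0"
  shows "orthonormal_or_zero {..<n} e"
  unfolding orthonormal_or_zero_def
proof (intro conjI ballI impI)
  fix j k assume "j \<in> {..<n}" "k \<in> {..<n}" and ne: "j \<noteq> k"
  then have n: "j < n" "k < n" by simp_all
  show "cinner (e j) (e k) = 0"
  proof (cases "j < k")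
    case True
    then show ?thesis
      using assms(2)[of j k] n(2) by (subst cinner_eq_zero_commute) simp
  next
    case False
    then show ?thesis using assms(2)[of k j] n(1) ne by simp
  qed
qed (simp add: assms(1))

lemma orthonormal_or_zero_UNIV_I:
  assumes "\<And>n. orthonormal_or_zero {..<n::nat} e"
  shows "orthonormal_or_zero UNIV e"
  unfolding orthonormal_or_zero_def
proof (intro conjI ballI impI)
  show "cinner (e j) (e k) = 0" if "j \<noteq> k" for j k
    using orthonormal_or_zero_orth[OF assms[of "Suc (max j k)"], of j k] that by simp
  show "norm (e k) = 1 \<or> e k = 0" for k
    using orthonormal_or_zero_norm[OF assms[of "Suc k"], of k] by simp
qed

text \<open>The Gram-Schmidt step: \<open>r\<close> is the normalized component of \<open>x\<close> orthogonal to the given vectors,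
  or zero if \<open>x\<close> already lies in their span.\<close>

lemma normalized_residual:
  fixes e :: "nat \<Rightarrow> 'a::complex_inner"
  assumes oz: "orthonormal_or_zero {..<n} e" and S: "csubspace S"
    and eS: "\<And>m. m < n \<Longrightarrow> e m \<in> S" and x: "x \<in> S"
  obtains r where "r \<in> S" "norm r = 1 \<or> r = 0" "\<And>m. m < n \<Longrightarrow> cinner r (e m) = 0"
    "x = (\<Sum>m<n. cinner x (e m) *\<^sub>C e m) + cinner x r *\<^sub>C r"
proof -
  define s where "s = (\<Sum>m<n. cinner x (e m) *\<^sub>C e m)"
  define y where "y = x - s"
  define r where "r = complex_of_real (1 / norm y) *\<^sub>C y"
  have y_orth: "cinner y (e m) = 0" if "m < n" for m
    unfolding y_def s_def by (rule residual_orthogonal[OF oz]) (use that in auto)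
  have "s \<in> S"
    unfolding s_def using eS
    by (intro complex_vector.subspace_sum[OF S] complex_vector.subspace_scale[OF S]) simp
  then have "y \<in> S"
    unfolding y_def by (rule complex_vector.subspace_diff[OF S x])
  have r: "norm r = 1 \<or> r = 0"
    by (cases "y = 0") (simp_all add: r_def norm_scaleC norm_divide)
  have r_orth: "cinner r (e m) = 0" if "m < n" for m
    using y_orth[OF that] by (simp add: r_def cinner_scaleC_left)
  have y_r: "complex_of_real (norm y) *\<^sub>C r = y"
    by (cases "y = 0") (simp_all add: r_def scaleC_scaleC scaleC_one)
  have "cinner (e m) r = 0" if "m < n" for m
    using r_orth[OF that] by (subst cinner_eq_zero_commute)
  then have "cinner s r = 0"
    by (simp add: s_def cinner_sum_left cinner_scaleC_left)
  then have "cinner x r = cinner y r"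
    by (simp add: y_def cinner_diff_left)
  also have "\<dots> = complex_of_real (norm y) * cinner r r"
    by (subst y_r[symmetric]) (simp add: cinner_scaleC_left)
  finally have "cinner x r *\<^sub>C r = complex_of_real (norm y) *\<^sub>C cinner r r *\<^sub>C r"
    by (simp add: scaleC_scaleC)
  also have "\<dots> = y"
    by (simp only: cinner_same_scaleC[OF r] y_r)
  finally have "x = s + cinner x r *\<^sub>C r"
    by (simp add: y_def)
  moreover have "r \<in> S"
    unfolding r_def by (rule complex_vector.subspace_scale[OF S \<open>y \<in> S\<close>])
  ultimately show thesis
    unfolding s_def by (intro that[of r] r r_orth)
qed

lemma Gram_Schmidt:
  fixes d :: "nat \<Rightarrow> 'a::complex_inner"
  assumes S: "csubspace S" and d: "\<And>n. d n \<in> S"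
  obtains e where "orthonormal_or_zero UNIV e" "\<And>n. e n \<in> S"
    "\<And>n. d n = (\<Sum>m\<le>n. cinner (d n) (e m) *\<^sub>C e m)"
proof -
  define P where "P e n r \<longleftrightarrow> r \<in> S \<and> (norm r = 1 \<or> r = 0) \<and> (\<forall>m<n. cinner r (e m) = 0) \<and>
    d n = (\<Sum>m<n. cinner (d n) (e m) *\<^sub>C e m) + cinner (d n) r *\<^sub>C r" for e :: "nat \<Rightarrow> 'a" and n r
  have oz: "orthonormal_or_zero {..<n} e" if "\<And>m. m < n \<Longrightarrow> P e m (e m)" for e n
    by (rule orthonormal_or_zero_sequenceI) (use that in \<open>simp_all add: P_def\<close>)
  have "\<exists>e. \<forall>n. P e n (e n)"
  proof (rule dependent_wellorder_choice)
    show "P f n r = P g n r" if "\<And>m. m < n \<Longrightarrow> f m = g m" for r f g n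
      using that by (simp add: P_def)
  next
    fix n e assume e: "\<And>m. m < n \<Longrightarrow> P e m (e m)"
    have eS: "e m \<in> S" if "m < n" for m
      using e[OF that] by (simp add: P_def)
    obtain r where "r \<in> S" "norm r = 1 \<or> r = 0" "\<And>m. m < n \<Longrightarrow> cinner r (e m) = 0"
      "d n = (\<Sum>m<n. cinner (d n) (e m) *\<^sub>C e m) + cinner (d n) r *\<^sub>C r"
      by (rule normalized_residual[of n e S "d n"]) (assumption | rule oz[OF e] S eS d that)+
    then have "P e n r"
      unfolding P_def by (intro conjI allI impI)
    then show "\<exists>r. P e n r" ..
  qed
  then obtain e where e: "\<And>n. P e n (e n)" by blast
  show thesis
  proof
    show "orthonormal_or_zero UNIV e"
      by (intro orthonormal_or_zero_UNIV_I oz e)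
    show "e n \<in> S" for n
      using e[of n] by (simp add: P_def)
    show "d n = (\<Sum>m\<le>n. cinner (d n) (e m) *\<^sub>C e m)" for n
      using e[of n] by (simp add: P_def flip: lessThan_Suc_atMost)
  qed
qed

text \<open>No finite orthonormal family spans the space, so the Gram-Schmidt step can always be applied to
  a vector with a nonzero residual.\<close>

lemma infinite_orthonormal_sequence:
  assumes inf: "infinite_cdim (UNIV :: 'b::complex_inner set)"
  obtains f :: "nat \<Rightarrow> 'b::complex_inner" where "orthonormal_or_zero UNIV f" "\<And>n. f n \<noteq> 0"
proof -
  define P where "P f n r \<longleftrightarrow> norm r = 1 \<and> (\<forall>m<n. cinner r (f m) = 0)" for f :: "nat \<Rightarrow> 'b" and n r
  have oz: "orthonormal_or_zero {..<n} f" if "\<And>m. m < n \<Longrightarrow> P f m (f m)" for f n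
    by (rule orthonormal_or_zero_sequenceI) (use that in \<open>simp_all add: P_def\<close>)
  have "\<exists>f. \<forall>n. P f n (f n)"
  proof (rule dependent_wellorder_choice)
    show "P f n r = P g n r" if "\<And>m. m < n \<Longrightarrow> f m = g m" for r f g n
      using that by (simp add: P_def)
  next
    fix n f assume f: "\<And>m. m < n \<Longrightarrow> P f m (f m)"
    have "finite (f ` {..<n})" by simp
    then obtain x where x: "x \<notin> cspan (f ` {..<n})"
      using inf unfolding infinite_cdim_def by blast
    obtain r where "r \<in> (UNIV :: 'b set)" and r: "norm r = 1 \<or> r = 0" "\<And>m. m < n \<Longrightarrow> cinner r (f m) = 0"
      "x = (\<Sum>m<n. cinner x (f m) *\<^sub>C f m) + cinner x r *\<^sub>C r"
      by (rule normalized_residual[of n f UNIV x])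
        (assumption | rule oz[OF f] complex_vector.subspace_UNIV UNIV_I that)+
    have "(\<Sum>m<n. cinner x (f m) *\<^sub>C f m) \<in> cspan (f ` {..<n})"
      by (intro complex_vector.span_sum complex_vector.span_scale complex_vector.span_base imageI)
    then have "r \<noteq> 0"
      using x r(3) by auto
    then have "P f n r"
      using r(1,2) by (simp add: P_def)
    then show "\<exists>r. P f n r" ..
  qed
  then obtain f where f: "\<And>n. P f n (f n)" by blast
  show thesis
  proof
    show "orthonormal_or_zero UNIV f"
      by (intro orthonormal_or_zero_UNIV_I oz f)
    show "f n \<noteq> 0" for n
      using f[of n] by (auto simp: P_def)
  qed
qed

text \<open>Separability passes to subsets of a metric space: approximate each point of a countable
  dense set, whenever possible, by points of the subset.\<close>

lemma dense_sequence_in_subset: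
  fixes S :: "'a::metric_space set"
  assumes sep: "separable_space (euclidean :: 'a topology)" and "S \<noteq> {}"
  obtains d :: "nat \<Rightarrow> 'a" where "range d \<subseteq> S" "S \<subseteq> closure (range d)"
proof -
  obtain C :: "'a set" where C: "countable C" "closure C = UNIV"
    using sep by (auto simp: separable_space_def)
  obtain s0 where s0: "s0 \<in> S" using \<open>S \<noteq> {}\<close> by blast
  define near where "near c n s \<longleftrightarrow> s \<in> S \<and> dist s c < 1 / real (Suc n)" for c n s
  \<comment> \<open>where \<open>S\<close> has no point near \<open>c\<close>, the value \<open>s0\<close> keeps the range of \<open>p\<close> inside \<open>S\<close>\<close>
  define p where "p = (\<lambda>(c, n). if \<exists>s. near c n s then SOME s. near c n s else s0)"
  have p: "near c n (p (c, n))" if "near c n s" for c n s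
    using that someI[of "near c n" s] by (auto simp: p_def)
  have pS: "p (c, n) \<in> S" for c n
    using p[of c n] s0 by (cases "\<exists>s. near c n s") (auto simp: p_def near_def)
  let ?D = "p ` (C \<times> (UNIV :: nat set))"
  have "C \<noteq> {}" using C(2) by auto
  then have "?D \<noteq> {}" by simp
  moreover have "countable ?D" using C(1) by simp
  ultimately have range: "range (from_nat_into ?D) = ?D" by (rule range_from_nat_into)
  show thesis
  proof
    show "range (from_nat_into ?D) \<subseteq> S" unfolding range using pS by auto
    show "S \<subseteq> closure (range (from_nat_into ?D))"
      unfolding range
    proof
      fix s assume s: "s \<in> S"
      show "s \<in> closure ?D"
        unfolding closure_approachable
      proof (intro allI impI)
        fix e :: real assume "e > 0"
        then obtain n where n: "1 / real (Suc n) < e / 2"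
          using nat_approx_posE[of "e / 2"] by auto
        have "s \<in> closure C" using C(2) by simp
        then obtain c where c: "c \<in> C" "dist c s < 1 / real (Suc n)"
          unfolding closure_approachable by (meson of_nat_0_less_iff zero_less_Suc zero_less_divide_1_iff)
        then have "near c n s" using s by (simp add: near_def dist_commute)
        from p[OF this] have "dist (p (c, n)) c < 1 / real (Suc n)" by (simp add: near_def)
        then have "dist (p (c, n)) s < e"
          using c(2) n dist_triangle[of "p (c, n)" s c] by linarith
        then show "\<exists>y\<in>?D. dist y s < e" using c(1) by blast
      qed
    qed
  qed
qed

text \<open>The vectors fixed by the projection \<open>transport e e\<close> form a closed subspace, and this
  subspace contains the dense sequence from which \<open>e\<close> was built.\<close>

lemma orthonormal_basis_separable:
  fixes S :: "'a::chilbert_space set"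
  assumes sep: "separable_space (euclidean :: 'a topology)" and S: "chilbert_subspace S"
  obtains e :: "nat \<Rightarrow> 'a" where "orthonormal_or_zero UNIV e" "\<And>n. e n \<in> S"
    "\<And>x. x \<in> S \<Longrightarrow> transport e e x = x"
proof -
  have sub: "csubspace S" using S unfolding chilbert_subspace_def by blast
  have "S \<noteq> {}" using complex_vector.subspace_0[OF sub] by auto
  then obtain d :: "nat \<Rightarrow> 'a" where d: "range d \<subseteq> S" "S \<subseteq> closure (range d)"
    using dense_sequence_in_subset[OF sep] by blast
  have dS: "d n \<in> S" for n using d(1) by auto
  obtain e where e: "orthonormal_or_zero UNIV e" "\<And>n. e n \<in> S"
    and sum: "\<And>n. d n = (\<Sum>m\<le>n. cinner (d n) (e m) *\<^sub>C e m)"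
    by (rule Gram_Schmidt[of S d, OF sub dS]) (rule that)
  let ?F = "{x. transport e e x = x}"
  have "csubspace ?F" and "closed ?F"
    using transport_self_fixed_subspace[OF e(1)] unfolding chilbert_subspace_def by blast+
  have "e m \<in> ?F" for m
    by (simp add: transport_basis[OF e(1) e(1)])
  then have "(\<Sum>m\<le>n. cinner (d n) (e m) *\<^sub>C e m) \<in> ?F" for n
    by (intro complex_vector.subspace_sum[OF \<open>csubspace ?F\<close>]
        complex_vector.subspace_scale[OF \<open>csubspace ?F\<close>])
  then have "range d \<subseteq> ?F"
    using sum by (metis (no_types, lifting) image_subsetI)
  then have "S \<subseteq> ?F"
    using closure_minimal[OF _ \<open>closed ?F\<close>] d(2) by blast
  then show thesis using that[OF e] by blast
qed

section \<open>A shift that solves the eigenvalue problem on a disc\<close>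

text \<open>\<open>H'\<close> is a copy of \<open>\<ell>\<^sup>2(N)\<close>, \<open>C\<close> is \<open>r\<close> times the backward shift and \<open>B\<close> reads off the zeroth entry. For
  \<open>\<bar>z\<bar> < r\<close> the eigenvector of \<open>C\<close> with zeroth entry \<open>x\<close> is the geometric sequence \<open>(z / r)\<^sup>n x\<close>, and
  the equation \<open>z k - C k = y\<close> has exactly one solution with zeroth entry \<open>0\<close>. With the forward shift
  \<open>D\<close>, the zeroth-entry embedding \<open>E\<close> and \<open>G = (I - (z / r) D)\<^sup>-\<^sup>1\<close>, these are \<open>G E x\<close> and \<open>- D G y / r\<close>.\<close>

lemma weighted_backward_shift:
  fixes N :: "'a::chilbert_space set"
  assumes sep: "separable_space (euclidean :: 'a topology)" and N: "chilbert_subspace N"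
    and inf: "infinite_cdim (UNIV :: 'b::chilbert_space set)" and r: "0 < r"
  obtains H' :: "'b::chilbert_space set" and B C where
    "chilbert_subspace H'" "B \<in> bounded_ops_between H' N" "C \<in> bounded_ops H'"
    "\<And>z. cmod z < r \<Longrightarrow> \<exists>J\<in>bounded_ops_between N H'. \<exists>V\<in>bounded_ops H'.
       (\<forall>x\<in>N. C (J x) = z *\<^sub>C J x \<and> B (J x) = x) \<and>
       (\<forall>k\<in>H'. z *\<^sub>C V k - C (V k) = k \<and> B (V k) = 0)"
    "\<And>z k. k \<in> H' \<Longrightarrow> C k = z *\<^sub>C k \<Longrightarrow> B k = 0 \<Longrightarrow> k = 0"
proof -
  obtain e :: "nat \<Rightarrow> 'a" where e: "orthonormal_or_zero UNIV e" and eN: "\<And>n. e n \<in> N"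
    and e_fix: "\<And>x. x \<in> N \<Longrightarrow> transport e e x = x"
    by (rule orthonormal_basis_separable[OF sep N]) (rule that)
  obtain f :: "nat \<Rightarrow> 'b" where f: "orthonormal_or_zero UNIV f" and f0: "\<And>n. f n \<noteq> 0"
    by (rule infinite_orthonormal_sequence[OF inf]) (rule that)

  \<comment> \<open>\<open>g (n, i)\<close> stands for \<open>e i\<close> in the \<open>n\<close>-th entry; it vanishes with \<open>e i\<close>, so the span of the
      family is \<open>\<ell>\<^sup>2(N)\<close> even when \<open>N\<close> is finite-dimensional.\<close>
  define g where "g k = (if e (snd k) = 0 then 0 else f (prod_encode k))" for k :: "nat \<times> nat"
  define up where "up k = (Suc (fst k), snd k)" for k :: "nat \<times> nat"
  define g0 where "g0 i = g (0, i)" for i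
  define g' where "g' k = g (up k)" for k
  have g_orth: "cinner (g j) (g k) = 0" if "j \<noteq> k" for j k
    using that orthonormal_or_zero_orth[OF f, of "prod_encode j" "prod_encode k"]
    by (simp add: g_def)
  have g_norm: "norm (g k) = 1 \<or> g k = 0" for k
    using orthonormal_or_zero_norm[OF f, of "prod_encode k"] f0 by (simp add: g_def)
  have g: "orthonormal_or_zero UNIV g"
    unfolding orthonormal_or_zero_def by (simp add: g_orth g_norm)
  have g0: "orthonormal_or_zero UNIV g0"
    unfolding orthonormal_or_zero_def g0_def by (simp add: g_orth g_norm)
  have g': "orthonormal_or_zero UNIV g'"
    unfolding orthonormal_or_zero_def g'_def
    by (simp add: g_norm) (simp add: g_orth up_def prod_eq_iff)
  have g_zero: "g k = 0 \<longleftrightarrow> e (snd k) = 0" for k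
    using f0 by (simp add: g_def)
  have g0_zero: "g0 i = 0 \<longleftrightarrow> e i = 0" for i
    by (simp add: g0_def g_zero)
  have g'_zero: "g' k = 0 \<longleftrightarrow> g k = 0" for k
    by (simp add: g'_def g_zero up_def)

  define H' where "H' = {x. transport g g x = x}"
  have H': "chilbert_subspace H'"
    unfolding H'_def by (rule transport_self_fixed_subspace[OF g])
  then have sub: "csubspace H'"
    unfolding chilbert_subspace_def by (rule conjunct1)
  have gH: "g k \<in> H'" for k
    unfolding H'_def by (simp add: transport_basis[OF g g])
  have g0H: "g0 i \<in> H'" and g'H: "g' k \<in> H'" for i k
    by (simp_all add: g0_def g'_def gH)

  define S where "S = transport g' g"
  define D where "D = transport g g'"
  define B where "B = transport g0 e"
  define E where "E = transport e g0"
  have S_mem: "S x \<in> H'" and D_mem: "D x \<in> H'" and E_mem: "E y \<in> H'" and B_mem: "B x \<in> N" for x y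
    unfolding S_def D_def E_def B_def
    by (rule transport_in_subspace[OF g' g H' gH] transport_in_subspace[OF g g' H' g'H]
        transport_in_subspace[OF e g0 H' g0H] transport_in_subspace[OF g0 e N eN])+
  have S: "S \<in> bounded_ops H'"
    unfolding S_def
    by (rule bounded_ops_subset[OF transport_bounded_ops[OF g' g]])
      (simp_all add: S_mem[unfolded S_def])
  have D: "D \<in> bounded_ops H'"
    unfolding D_def
    by (rule bounded_ops_subset[OF transport_bounded_ops[OF g g']])
      (simp_all add: D_mem[unfolded D_def])
  have E: "E \<in> bounded_ops_between N H'"
    unfolding E_def
    by (rule bounded_ops_subset[OF transport_bounded_ops[OF e g0]])
      (simp_all add: E_mem[unfolded E_def])
  have B: "B \<in> bounded_ops_between H' N"
    unfolding B_def
    by (rule bounded_ops_subset[OF transport_bounded_ops[OF g0 e]])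
      (simp_all add: B_mem[unfolded B_def])
  have SD: "S (D x) = x" if "x \<in> H'" for x
  proof -
    have "S (D x) = transport g g x"
      unfolding S_def D_def by (rule transport_transport[OF g g']) (simp add: g'_zero)
    then show ?thesis using that by (simp add: H'_def)
  qed
  have BE: "B (E x) = x" if "x \<in> N" for x
  proof -
    have "B (E x) = transport e e x"
      unfolding B_def E_def by (rule transport_transport[OF e g0]) (simp add: g0_zero)
    then show ?thesis using e_fix[OF that] by simp
  qed
  have BD: "B (D x) = 0" for x
    unfolding B_def
  proof (rule transport_eq_0)
    show "cinner (D x) (g0 i) = 0" for i
      unfolding D_def
      by (rule cinner_transport_orthogonal[OF g g']) (simp add: g'_def g0_def up_def g_orth)
  qed
  have SE: "S (E x) = 0" for x
    unfolding S_def
  proof (rule transport_eq_0)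
    show "cinner (E x) (g' k) = 0" for k
      unfolding E_def
      by (rule cinner_transport_orthogonal[OF e g0]) (simp add: g'_def g0_def up_def g_orth)
  qed

  define C where "C x = complex_of_real r *\<^sub>C S x" for x
  have C: "C \<in> bounded_ops H'"
    unfolding C_def by (rule bounded_ops_cmult[OF S sub])

  have solve: "\<exists>J\<in>bounded_ops_between N H'. \<exists>V\<in>bounded_ops H'.
       (\<forall>x\<in>N. C (J x) = z *\<^sub>C J x \<and> B (J x) = x) \<and>
       (\<forall>k\<in>H'. z *\<^sub>C V k - C (V k) = k \<and> B (V k) = 0)" if z: "cmod z < r" for z
  proof -
    define a where "a = z / complex_of_real r"
    have ra: "complex_of_real r * a = z" using r by (simp add: a_def)
    have A: "(\<lambda>x. a *\<^sub>C D x) \<in> bounded_ops H'"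
      by (rule bounded_ops_cmult[OF D sub])
    have A_le: "norm (a *\<^sub>C D x) \<le> cmod a * norm x" for x
      unfolding norm_scaleC D_def by (intro mult_left_mono norm_transport_le[OF g g']) simp
    have a: "0 \<le> cmod a" "cmod a < 1"
      using z r by (simp_all add: a_def norm_divide)
    obtain G where G: "G \<in> bounded_ops H'"
      and G_eq: "\<And>y. y \<in> H' \<Longrightarrow> G y - a *\<^sub>C D (G y) = y"
      by (rule contraction_resolvent[OF H' A a A_le]) (rule that)
    have G_mem: "G y \<in> H'" if "y \<in> H'" for y
      using bounded_ops_mem[OF G that] .
    have G_step: "G y = y + a *\<^sub>C D (G y)" if "y \<in> H'" for y
      using G_eq[OF that] by (simp add: algebra_simps)
    have SG: "S (G y) = S y + a *\<^sub>C G y" if "y \<in> H'" for y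
    proof -
      have "S (G y) = S (y + a *\<^sub>C D (G y))"
        using G_step[OF that] by (rule arg_cong)
      also have "\<dots> = S y + a *\<^sub>C S (D (G y))"
        by (simp only: bounded_ops_add[OF S that complex_vector.subspace_scale[OF sub D_mem]]
            bounded_ops_scaleC[OF S D_mem])
      finally show ?thesis by (simp only: SD[OF G_mem[OF that]])
    qed
    have BG: "B (G y) = B y" if "y \<in> H'" for y
    proof -
      have "B (G y) = B (y + a *\<^sub>C D (G y))"
        using G_step[OF that] by (rule arg_cong)
      also have "\<dots> = B y + a *\<^sub>C B (D (G y))"
        by (simp only: bounded_ops_add[OF B that complex_vector.subspace_scale[OF sub D_mem]]
            bounded_ops_scaleC[OF B D_mem])
      finally show ?thesis by (simp add: BD)
    qed
    define c where "c = - (1 / complex_of_real r)"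
    have rc: "complex_of_real r * c = - 1" and zc: "z * c = - a"
      using r by (simp_all add: c_def a_def)
    show ?thesis
    proof (intro bexI conjI ballI)
      show "(\<lambda>x. G (E x)) \<in> bounded_ops_between N H'"
        by (rule bounded_ops_compose[OF E G])
      show "(\<lambda>k. c *\<^sub>C D (G k)) \<in> bounded_ops H'"
        by (rule bounded_ops_cmult[OF bounded_ops_compose[OF G D] sub])
    next
      fix x assume x: "x \<in> N"
      show "C (G (E x)) = z *\<^sub>C G (E x)"
        by (simp add: C_def SG[OF E_mem] SE scaleC_scaleC ra)
      show "B (G (E x)) = x"
        by (simp only: BG[OF E_mem] BE[OF x])
    next
      fix k assume k: "k \<in> H'"
      have "C (c *\<^sub>C D (G k)) = (complex_of_real r * c) *\<^sub>C G k"
        by (simp only: C_def bounded_ops_scaleC[OF S D_mem] SD[OF G_mem[OF k]] scaleC_scaleC)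
      then have "z *\<^sub>C c *\<^sub>C D (G k) - C (c *\<^sub>C D (G k)) = G k - a *\<^sub>C D (G k)"
        by (simp add: rc zc scaleC_scaleC)
      then show "z *\<^sub>C c *\<^sub>C D (G k) - C (c *\<^sub>C D (G k)) = k"
        by (simp only: G_eq[OF k])
      show "B (c *\<^sub>C D (G k)) = 0"
        by (simp add: bounded_ops_scaleC[OF B D_mem] BD)
    qed
  qed

  have uniq: "k = 0" if k: "k \<in> H'" and Ck: "C k = z *\<^sub>C k" and Bk: "B k = 0" for z k
  proof -
    have coord: "cinner k (g (n, i)) = 0" for n i
    proof (induction n)
      case 0
      have "cinner (B k) (e i) = cinner k (g0 i)"
        unfolding B_def by (rule cinner_transport[OF g0 e]) (simp add: g0_zero)
      then show ?case by (simp add: Bk g0_def)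
    next
      case (Suc n)
      have "cinner (S k) (g (n, i)) = cinner k (g' (n, i))"
        unfolding S_def by (rule cinner_transport[OF g' g]) (simp add: g'_zero)
      then have "complex_of_real r * cinner k (g (Suc n, i)) = cinner (C k) (g (n, i))"
        by (simp add: C_def cinner_scaleC_left g'_def up_def)
      also have "\<dots> = 0"
        by (simp add: Ck cinner_scaleC_left Suc.IH)
      finally show ?case using r by simp
    qed
    have "cinner k (g j) = 0" for j
      using coord[of "fst j" "snd j"] by simp
    then have "transport g g k = 0"
      by (rule transport_eq_0)
    then show ?thesis using k by (simp add: H'_def)
  qed

  show thesis
    by (rule that[OF H' B C solve uniq])
qed

section \<open>Left resolvents and resolvents of extensions\<close>

lemma shift_op_bounded_ops:
  assumes "T \<in> bounded_ops S" "csubspace S"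
  shows "shift_op z T \<in> bounded_ops S"
  unfolding shift_op_def
  by (intro bounded_ops_minus bounded_ops_cmult bounded_ops_ident assms)

lemma resolvent_on_eq:
  assumes R: "\<And>p. p \<in> S \<Longrightarrow> R (shift_op z T p) = p"
    and inv: "R p \<in> S" "shift_op z T (R p) = p"
  shows "resolvent_on S T z p = R p"
  unfolding resolvent_on_def
  by (rule inv_into_f_eq[OF inj_on_inverseI[of S R, OF R] inv])

text \<open>The resolvent has a vanishing upper right entry, so its first component depends on the first
  component of the argument only. Hence \<open>R z (z I - T') = I\<close> on \<open>H\<close> gives left invertibility, and
  the resolvent identity of \<open>T'\<close> at \<open>(x, 0)\<close> has the identity for \<open>L\<close> as its first component.\<close>

lemma left_resolvent_of_extension:
  fixes T :: "'a::complex_inner \<Rightarrow> 'a" and H' :: "'b::complex_inner set"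
  assumes H': "csubspace H'" and ext: "extension_on UNIV H' T T'"
    and inv: "\<And>z. z \<in> \<Omega> \<Longrightarrow> invertible_on (UNIV \<times> H') (shift_op z T')"
    and row: "\<And>z h k. z \<in> \<Omega> \<Longrightarrow> k \<in> H' \<Longrightarrow> fst (resolvent_on (UNIV \<times> H') T' z (h, k)) = L z h"
    and L: "\<And>z. z \<in> \<Omega> \<Longrightarrow> L z \<in> bounded_ops UNIV"
  shows "left_resolvent_on UNIV T \<Omega> L"
proof -
  let ?S = "UNIV \<times> H'"
  have zero: "0 \<in> H'" by (rule complex_vector.subspace_0[OF H'])
  have "\<exists>R. R \<in> bounded_ops ?S \<and> (\<forall>p\<in>?S. R (shift_op z T' p) = p) \<and>
      (\<forall>p\<in>?S. shift_op z T' (R p) = p)" if "z \<in> \<Omega>" for z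
    using inv[OF that] unfolding invertible_on_def Bex_def .
  then obtain R where R: "\<And>z. z \<in> \<Omega> \<Longrightarrow> R z \<in> bounded_ops ?S"
    and left: "\<And>z p. z \<in> \<Omega> \<Longrightarrow> p \<in> ?S \<Longrightarrow> R z (shift_op z T' p) = p"
    and right: "\<And>z p. z \<in> \<Omega> \<Longrightarrow> p \<in> ?S \<Longrightarrow> shift_op z T' (R z p) = p"
    by metis
  have fst_R: "fst (R z p) = L z (fst p)" if z: "z \<in> \<Omega>" and p: "p \<in> ?S" for z p
  proof -
    have "resolvent_on ?S T' z p = R z p"
      by (rule resolvent_on_eq[OF left[OF z] bounded_ops_mem[OF R[OF z] p] right[OF z p]])
    then show ?thesis
      using row[OF z, of "snd p" "fst p"] p by auto
  qed
  have left_inverse: "L z (shift_op z T x) = x" if z: "z \<in> \<Omega>" for z x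
  proof -
    have "T' (x, 0) = (T x, 0)" using ext by (simp add: extension_on_def)
    then have eq: "shift_op z T' (x, 0) = (shift_op z T x, 0)"
      by (simp add: shift_op_def scaleC_prod_def)
    have "fst (R z (shift_op z T x, 0)) = x"
      using left[OF z, of "(x, 0)"] zero unfolding eq by simp
    then show ?thesis
      using fst_R[OF z, of "(shift_op z T x, 0)"] zero by simp
  qed
  have identity: "L z x - L w x = (w - z) *\<^sub>C L z (L w x)" if z: "z \<in> \<Omega>" and w: "w \<in> \<Omega>" for z w x
  proof -
    let ?a = "R w (x, 0)"
    have x: "(x, 0) \<in> ?S" using zero by simp
    have a: "?a \<in> ?S" by (rule bounded_ops_mem[OF R[OF w] x])
    have wa: "(w - z) *\<^sub>C ?a \<in> ?S"
      using a complex_vector.subspace_scale[OF H'] by (auto simp: scaleC_prod_def)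
    have za: "shift_op z T' ?a \<in> ?S"
    proof -
      have "T' \<in> bounded_ops ?S" using ext by (simp add: extension_on_def)
      from bounded_ops_mem[OF this a] have "T' ?a \<in> ?S" .
      then show ?thesis
        using a complex_vector.subspace_scale[OF H'] complex_vector.subspace_diff[OF H']
        by (auto simp: scaleC_prod_def shift_op_def)
    qed
    have "(x, 0) = shift_op w T' ?a"
      by (rule right[OF w x, symmetric])
    also have "\<dots> = shift_op z T' ?a + (w - z) *\<^sub>C ?a"
      by (simp add: shift_op_def complex_vector.scale_left_diff_distrib)
    finally have "R z (x, 0) = R z (shift_op z T' ?a + (w - z) *\<^sub>C ?a)"
      by (rule arg_cong)
    also have "\<dots> = ?a + (w - z) *\<^sub>C R z ?a"
      by (simp only: bounded_ops_add[OF R[OF z] za wa] bounded_ops_scaleC[OF R[OF z] a] left[OF z a])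
    finally have "fst (R z (x, 0)) = fst ?a + (w - z) *\<^sub>C fst (R z ?a)"
      by (simp add: scaleC_prod_def)
    then have "L z x = L w x + (w - z) *\<^sub>C L z (L w x)"
      by (simp add: fst_R[OF z x] fst_R[OF w x] fst_R[OF z a])
    then show ?thesis by simp
  qed
  have "\<Omega> \<subseteq> left_resolvent_set UNIV T"
    unfolding left_resolvent_set_def left_invertible_on_def
    using L left_inverse by (intro subsetI CollectI bexI ballI) simp_all
  moreover have "L z x - L w x = (w - z) *\<^sub>C L z (L w x)"
    if "C \<in> components \<Omega>" "z \<in> C" "w \<in> C" for C z w x
    using in_components_subset[OF that(1)] that(2,3) by (intro identity) auto
  ultimately show ?thesis
    unfolding left_resolvent_on_def by (simp add: L left_inverse)
qed

text \<open>\<open>L w\<close> is a left multiple of \<open>L z\<close>, so all \<open>L z\<close> have the same kernel \<open>N\<close>, and the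
  shift over \<open>N\<close> fills the gap between \<open>H\<close> and the range of \<open>z I - T\<close> for every \<open>z \<in> \<Omega>\<close>
  at once. Taking the range of \<open>V z\<close> inside the kernel of \<open>B\<close> makes the upper right
  entry of the resolvent vanish.\<close>

lemma extension_of_left_resolvent:
  fixes T :: "'a::chilbert_space \<Rightarrow> 'a"
  assumes sep: "separable_space (euclidean :: 'a topology)"
    and inf: "infinite_cdim (UNIV :: 'b::chilbert_space set)"
    and T: "T \<in> bounded_ops UNIV"
    and conn: "connected \<Omega>" and spec: "\<Omega> \<subseteq> spectrum_on UNIV T"
    and res: "left_resolvent_on UNIV T \<Omega> L"
  shows "\<exists>(H' :: 'b set) T' A V. chilbert_subspace H' \<and> extension_on UNIV H' T T' \<and>
    (\<forall>z\<in>\<Omega>. invertible_on (UNIV \<times> H') (shift_op z T') \<and>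
      A z \<in> bounded_ops_between UNIV H' \<and> V z \<in> bounded_ops H' \<and>
      (\<forall>h. \<forall>k\<in>H'. resolvent_on (UNIV \<times> H') T' z (h, k) = (L z h, A z h + V z k)))"
proof -
  have UNIV: "csubspace (UNIV :: 'a set)" by (rule complex_vector.subspace_UNIV)
  have L: "L z \<in> bounded_ops UNIV" and left: "L z (shift_op z T x) = x" if "z \<in> \<Omega>" for z x
    using res that by (simp_all add: left_resolvent_on_def)
  have identity: "L z x - L w x = (w - z) *\<^sub>C L z (L w x)" if z: "z \<in> \<Omega>" and w: "w \<in> \<Omega>" for z w x
  proof -
    have "\<Omega> \<in> components \<Omega>"
      using conn z by (auto simp: in_components_self)
    then show ?thesis using res z w by (simp add: left_resolvent_on_def)
  qed
  have L0: "L z 0 = 0" if "z \<in> \<Omega>" for z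
    using bounded_ops_scaleC[OF L[OF that] UNIV_I, of 0 0] by simp

  \<comment> \<open>the common kernel; as an intersection it makes sense also for empty \<open>\<Omega>\<close>\<close>
  define N where "N = (\<Inter>z\<in>\<Omega>. {x. L z x = 0})"
  have ker: "chilbert_subspace {x. L z x = 0}" if "z \<in> \<Omega>" for z
    by (rule chilbert_subspace_kernel[OF L[OF that]])
  have N: "chilbert_subspace N"
    unfolding chilbert_subspace_def N_def
    by (intro conjI complex_vector.subspace_Int closed_INT ballI)
      (use ker in \<open>simp_all add: chilbert_subspace_def\<close>)
  have N_L: "L z x = 0" if "x \<in> N" "z \<in> \<Omega>" for x z
    using that by (simp add: N_def)
  have L_N: "x \<in> N" if z: "z \<in> \<Omega>" and x: "L z x = 0" for x z
  proof -
    have "L w x = 0" if w: "w \<in> \<Omega>" for w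
      using identity[OF w z, of x] by (simp add: x L0[OF w])
    then show ?thesis by (simp add: N_def)
  qed

  obtain r where r: "r > 0" "\<And>z. z \<in> spectrum_on UNIV T \<Longrightarrow> cmod z < r"
    by (rule spectrum_bounded[OF T]) (rule that)
  obtain H' :: "'b set" and B C where H': "chilbert_subspace H'"
    and B: "B \<in> bounded_ops_between H' N" and C: "C \<in> bounded_ops H'"
    and solve: "\<And>z. cmod z < r \<Longrightarrow> \<exists>J\<in>bounded_ops_between N H'. \<exists>V\<in>bounded_ops H'.
       (\<forall>x\<in>N. C (J x) = z *\<^sub>C J x \<and> B (J x) = x) \<and>
       (\<forall>k\<in>H'. z *\<^sub>C V k - C (V k) = k \<and> B (V k) = 0)"
    and uniq: "\<And>z k. k \<in> H' \<Longrightarrow> C k = z *\<^sub>C k \<Longrightarrow> B k = 0 \<Longrightarrow> k = 0"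
    by (rule weighted_backward_shift[OF sep N inf r(1)]) (rule that)
  have sub: "csubspace H'" using H' unfolding chilbert_subspace_def by (rule conjunct1)
  define good where "good z J V \<longleftrightarrow> J \<in> bounded_ops_between N H' \<and> V \<in> bounded_ops H' \<and>
       (\<forall>x\<in>N. C (J x) = z *\<^sub>C J x \<and> B (J x) = x) \<and>
       (\<forall>k\<in>H'. z *\<^sub>C V k - C (V k) = k \<and> B (V k) = 0)" for z J V
  have "\<exists>J V. good z J V" if "z \<in> \<Omega>" for z
    using solve[OF r(2)[OF subsetD[OF spec that]]] unfolding good_def
    by (elim bexE) (intro exI conjI; elim conjE; assumption)
  then obtain J V where good: "\<And>z. z \<in> \<Omega> \<Longrightarrow> good z (J z) (V z)"
    by metis
  have J: "J z \<in> bounded_ops_between N H'" and V: "V z \<in> bounded_ops H'" if "z \<in> \<Omega>" for z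
    using good[OF that] by (simp_all add: good_def)
  have CJ: "C (J z x) = z *\<^sub>C J z x" and BJ: "B (J z x) = x" if "z \<in> \<Omega>" "x \<in> N" for z x
    using good[OF that(1)] that(2) unfolding good_def by (elim conjE, simp only:)+
  have CV: "z *\<^sub>C V z k - C (V z k) = k" and BV: "B (V z k) = 0" if "z \<in> \<Omega>" "k \<in> H'" for z k
    using good[OF that(1)] that(2) unfolding good_def by (elim conjE, simp only:)+

  define P where "P z h = h - shift_op z T (L z h)" for z h
  have P_mem: "P z h \<in> N" if z: "z \<in> \<Omega>" for z h
  proof (rule L_N[OF z])
    show "L z (P z h) = 0"
      unfolding P_def bounded_ops_diff[OF L[OF z] UNIV UNIV_I UNIV_I] by (simp add: left[OF z])
  qed
  have P: "P z \<in> bounded_ops_between UNIV N" if z: "z \<in> \<Omega>" for z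
  proof (rule bounded_ops_subset[OF _ subset_refl P_mem[OF z]])
    show "P z \<in> bounded_ops UNIV"
      unfolding P_def
      by (intro bounded_ops_minus bounded_ops_ident UNIV
          bounded_ops_compose[OF L[OF z]] shift_op_bounded_ops[OF T])
  qed
  define A where "A z h = J z (P z h)" for z h
  have A: "A z \<in> bounded_ops_between UNIV H'" if "z \<in> \<Omega>" for z
    unfolding A_def by (rule bounded_ops_compose[OF P[OF that] J[OF that]])
  have V_mem: "V z k \<in> H'" and A_mem: "A z h \<in> H'" if "z \<in> \<Omega>" "k \<in> H'" for z k h
    using bounded_ops_mem[OF V[OF that(1)] that(2)] bounded_ops_mem[OF A[OF that(1)] UNIV_I] by simp_all

  let ?S = "(UNIV :: 'a set) \<times> H'"
  define T' where "T' p = (T (fst p) - B (snd p), C (snd p))" for p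
  have "T' \<in> bounded_ops ?S"
    unfolding T'_def
  proof (rule bounded_ops_Pair)
    show "(\<lambda>p. C (snd p)) \<in> bounded_ops_between ?S H'"
      by (rule bounded_ops_compose[OF bounded_ops_snd C])
    have "(\<lambda>p. B (snd p)) \<in> bounded_ops_between ?S N"
      by (rule bounded_ops_compose[OF bounded_ops_snd B])
    then have "(\<lambda>p. B (snd p)) \<in> bounded_ops_between ?S UNIV"
      by (rule bounded_ops_subset[OF _ subset_refl UNIV_I])
    then show "(\<lambda>p. T (fst p) - B (snd p)) \<in> bounded_ops_between ?S UNIV"
      by (rule bounded_ops_minus[OF bounded_ops_compose[OF bounded_ops_fst T] _ UNIV])
  qed
  moreover have "B 0 = 0" "C 0 = 0"
    using bounded_ops_scaleC[OF B complex_vector.subspace_0[OF sub], of 0]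
      bounded_ops_scaleC[OF C complex_vector.subspace_0[OF sub], of 0] by simp_all
  ultimately have ext: "extension_on UNIV H' T T'"
    by (simp add: extension_on_def T'_def)
  have shift_T': "shift_op z T' (h, k) = (shift_op z T h + B k, shift_op z C k)" for z h k
    by (simp add: T'_def shift_op_def scaleC_prod_def)

  define R where "R z p = (L z (fst p), A z (fst p) + V z (snd p))" for z p
  have R: "R z \<in> bounded_ops ?S" if "z \<in> \<Omega>" for z
    unfolding R_def
    by (intro bounded_ops_Pair bounded_ops_plus sub bounded_ops_compose[OF bounded_ops_fst]
        bounded_ops_compose[OF bounded_ops_snd] L[OF that] A[OF that] V[OF that])
  have right: "shift_op z T' (R z p) = p" if z: "z \<in> \<Omega>" and p: "p \<in> ?S" for z p
  proof -
    obtain h k where hk: "p = (h, k)" and k: "k \<in> H'" using p by auto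
    have A': "A z h \<in> H'" by (rule A_mem[OF z k])
    have V': "V z k \<in> H'" by (rule V_mem[OF z k])
    have "B (A z h + V z k) = P z h"
      unfolding bounded_ops_add[OF B A' V'] BV[OF z k] by (simp add: A_def BJ[OF z P_mem[OF z]])
    then have "shift_op z T (L z h) + B (A z h + V z k) = h"
      by (simp add: P_def)
    moreover have "shift_op z C (A z h + V z k) = (z *\<^sub>C A z h - C (A z h)) + (z *\<^sub>C V z k - C (V z k))"
      unfolding shift_op_def bounded_ops_add[OF C A' V'] by (simp add: scaleC_add_right)
    then have "shift_op z C (A z h + V z k) = k"
      unfolding CV[OF z k] by (simp add: A_def CJ[OF z P_mem[OF z]])
    ultimately show ?thesis
      by (simp add: hk R_def shift_T')
  qed
  \<comment> \<open>injectivity turns the right inverse \<open>R z\<close> into a two-sided one\<close>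
  have inj: "p = 0" if z: "z \<in> \<Omega>" and p: "p \<in> ?S" and eq: "shift_op z T' p = 0" for z p
  proof -
    obtain h k where hk: "p = (h, k)" and k: "k \<in> H'" using p by auto
    have eqs: "shift_op z T h + B k = 0" "shift_op z C k = 0"
      using eq unfolding hk shift_T' by (simp_all add: zero_prod_def)
    have "h + L z (B k) = L z (shift_op z T h + B k)"
      by (simp only: bounded_ops_add[OF L[OF z] UNIV_I UNIV_I] left[OF z])
    also have "\<dots> = 0" unfolding eqs(1) by (rule L0[OF z])
    finally have h: "h = 0"
      using N_L[OF bounded_ops_mem[OF B k] z] by simp
    have "shift_op z T 0 = 0"
      using bounded_ops_scaleC[OF shift_op_bounded_ops[OF T UNIV] UNIV_I, of z 0 0] by simp
    then have Bk: "B k = 0" using eqs(1) unfolding h by simp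
    have Ck: "C k = z *\<^sub>C k" using eqs(2) by (simp add: shift_op_def)
    have "k = 0" by (rule uniq[OF k Ck Bk])
    then show ?thesis by (simp add: hk h zero_prod_def)
  qed
  have S: "csubspace ?S"
    using complex_vector.subspace_0[OF sub]
      complex_vector.subspace_add[OF sub] complex_vector.subspace_scale[OF sub]
    by (intro complex_vector.subspaceI) (auto simp: scaleC_prod_def zero_prod_def)
  have T'_ops: "T' \<in> bounded_ops ?S" using ext by (simp add: extension_on_def)
  have left': "R z (shift_op z T' p) = p" if z: "z \<in> \<Omega>" and p: "p \<in> ?S" for z p
  proof -
    have shift: "shift_op z T' \<in> bounded_ops ?S"
      by (rule shift_op_bounded_ops[OF T'_ops S])
    have q: "shift_op z T' p \<in> ?S" by (rule bounded_ops_mem[OF shift p])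
    have Rq: "R z (shift_op z T' p) \<in> ?S" by (rule bounded_ops_mem[OF R[OF z] q])
    have "shift_op z T' (R z (shift_op z T' p) - p) = 0"
      unfolding bounded_ops_diff[OF shift S Rq p] right[OF z q] by simp
    from inj[OF z complex_vector.subspace_diff[OF S Rq p] this] show ?thesis by simp
  qed
  have "invertible_on ?S (shift_op z T')" if "z \<in> \<Omega>" for z
    unfolding invertible_on_def
    using left'[OF that] right[OF that] by (intro bexI[OF _ R[OF that]] conjI ballI)
  moreover have "resolvent_on ?S T' z (h, k) = (L z h, A z h + V z k)" if "z \<in> \<Omega>" "k \<in> H'" for z h k
  proof -
    have hk: "(h, k) \<in> ?S" using that(2) by simp
    show ?thesis
      using resolvent_on_eq[OF left'[OF that(1)] bounded_ops_mem[OF R[OF that(1)] hk]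
          right[OF that(1) hk]]
      by (simp add: R_def)
  qed
  ultimately show ?thesis
    using H' ext A V by (intro exI[of _ H'] exI[of _ T'] exI[of _ A] exI[of _ V]) simp
qed

theorem theorem3p2:
  fixes T :: "'a::chilbert_space \<Rightarrow> 'a"
    and \<Omega> :: "complex set"
    and L :: "complex \<Rightarrow> 'a \<Rightarrow> 'a"
  assumes separable_H: "separable_space (euclidean :: 'a topology)"
    and infinite_dim_H: "infinite_cdim (UNIV :: 'a set)"
    and T: "T \<in> bounded_ops UNIV"
    and open_\<Omega>: "open \<Omega>"
    and connected_\<Omega>: "connected \<Omega>"
    and \<Omega>_subset: "\<Omega> \<subseteq> left_resolvent_set UNIV T \<inter> spectrum_on UNIV T"
    and L: "\<And>z. z \<in> \<Omega> \<Longrightarrow> L z \<in> bounded_ops UNIV"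
    \<comment> \<open>\<open>'b\<close> is an arbitrary ambient Hilbert space, of any infinite dimension, in which the
        spaces \<open>H'\<close> are taken; every Hilbert space is a closed subspace of such a type\<close>
    and universe: "infinite_cdim (UNIV :: 'b::chilbert_space set)"
  shows "left_resolvent_on UNIV T \<Omega> L \<longleftrightarrow>
    (\<exists>(H' :: 'b set) T'.
       chilbert_subspace H' \<and>
       extension_on UNIV H' T T' \<and>
       (\<forall>z\<in>\<Omega>. invertible_on (UNIV \<times> H') (shift_op z T')) \<and>
       (\<exists>(A :: complex \<Rightarrow> 'a \<Rightarrow> 'b) (V :: complex \<Rightarrow> 'b \<Rightarrow> 'b).
          \<forall>z\<in>\<Omega>. A z \<in> bounded_ops_between UNIV H' \<and> V z \<in> bounded_ops H' \<and>
            (\<forall>h. \<forall>k\<in>H'. resolvent_on (UNIV \<times> H') T' z (h, k) = (L z h, A z h + V z k))))"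
proof
  assume "left_resolvent_on UNIV T \<Omega> L"
  from extension_of_left_resolvent[OF separable_H universe T connected_\<Omega> _ this] \<Omega>_subset
  obtain H' :: "'b set" and T' A V where "chilbert_subspace H'" "extension_on UNIV H' T T'"
    "\<forall>z\<in>\<Omega>. invertible_on (UNIV \<times> H') (shift_op z T') \<and>
      A z \<in> bounded_ops_between UNIV H' \<and> V z \<in> bounded_ops H' \<and>
      (\<forall>h. \<forall>k\<in>H'. resolvent_on (UNIV \<times> H') T' z (h, k) = (L z h, A z h + V z k))"
    by auto
  then show "(\<exists>(H' :: 'b set) T'.
       chilbert_subspace H' \<and>
       extension_on UNIV H' T T' \<and>
       (\<forall>z\<in>\<Omega>. invertible_on (UNIV \<times> H') (shift_op z T')) \<and>
       (\<exists>(A :: complex \<Rightarrow> 'a \<Rightarrow> 'b) (V :: complex \<Rightarrow> 'b \<Rightarrow> 'b).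
          \<forall>z\<in>\<Omega>. A z \<in> bounded_ops_between UNIV H' \<and> V z \<in> bounded_ops H' \<and>
            (\<forall>h. \<forall>k\<in>H'. resolvent_on (UNIV \<times> H') T' z (h, k) = (L z h, A z h + V z k))))"
    by (intro exI[of _ H'] exI[of _ T'] conjI exI[of _ A] exI[of _ V]) simp_all
next
  assume "(\<exists>(H' :: 'b set) T'.
       chilbert_subspace H' \<and>
       extension_on UNIV H' T T' \<and>
       (\<forall>z\<in>\<Omega>. invertible_on (UNIV \<times> H') (shift_op z T')) \<and>
       (\<exists>(A :: complex \<Rightarrow> 'a \<Rightarrow> 'b) (V :: complex \<Rightarrow> 'b \<Rightarrow> 'b).
          \<forall>z\<in>\<Omega>. A z \<in> bounded_ops_between UNIV H' \<and> V z \<in> bounded_ops H' \<and>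
            (\<forall>h. \<forall>k\<in>H'. resolvent_on (UNIV \<times> H') T' z (h, k) = (L z h, A z h + V z k))))"
  then obtain H' :: "'b set" and T' A V where H': "chilbert_subspace H'"
    and ext: "extension_on UNIV H' T T'"
    and inv: "\<forall>z\<in>\<Omega>. invertible_on (UNIV \<times> H') (shift_op z T')"
    and form: "\<forall>z\<in>\<Omega>. A z \<in> bounded_ops_between UNIV H' \<and> V z \<in> bounded_ops H' \<and>
      (\<forall>h. \<forall>k\<in>H'. resolvent_on (UNIV \<times> H') T' z (h, k) = (L z h, A z h + V z k))"
    by (elim exE conjE)
  show "left_resolvent_on UNIV T \<Omega> L"
  proof (rule left_resolvent_of_extension[OF _ ext _ _ L])
    show "csubspace H'" using H' unfolding chilbert_subspace_def by (rule conjunct1)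
  qed (use inv form in simp_all)
qed

end
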